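(* Let $(X,\|\cdot\|,\tau)$ be a sequentially complete d-consistent Mazur--Saks space with mixed topology $\gamma$ and $(T(t))_{t\geq 0}$ a bi-continuous semigroup on $X$ with generator $(A,D(A))$. Let $\Lambda$ be the set of all $\lambda\in\rho(A)$ such that $R(\lambda,A)^{\bullet}X^{\bullet}\subset D(A^{\bullet})$. Then for $x\in X$ the following assertions are equivalent, where in (ii) and (iii) "for some (all)" means that the version with "some" and the version with "all" are each equivalent to the other assertions: (i) $x\in Fav(T)$. (ii) For some (all) $\lambda\in\Lambda$ there exists a $\|\cdot\|$-bounded sequence $(y_{n})_{n\in\mathbb{N}}$ in $X$ with $\gamma\text{-}\lim_{n\to\infty}R(\lambda,A)y_{n}=x$. (iii) For some (all) $\lambda\in\Lambda$ there exist a $\|\cdot\|$-bounded sequence $(y_{n})_{n\in\mathbb{N}}$ in $X$ and $k\in\mathbb{N}_{0}$ with $\gamma\text{-}\lim_{n\to\infty}R(\lambda,A)^{k+1}y_{n}=R(\lambda,A)^{k}x$.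
   Context: Vector spaces are over $\mathbb{K}=\mathbb{R}$ or $\mathbb{C}$. For a Banach space $(X,\|\cdot\|)$, $X'$ is the norm dual with dual norm $\|\cdot\|_{X'}$ and $\mathcal{L}(X)$ the bounded operators on $X$. Let $(X,\|\cdot\|)$ be a Banach space and $\tau$ a Hausdorff locally convex topology on $X$ coarser than the norm topology $\tau_{\|\cdot\|}$. The mixed topology $\gamma=\gamma(\|\cdot\|,\tau)$ is the finest linear topology on $X$ that coincides with $\tau$ on $\|\cdot\|$-bounded sets and satisfies $\tau\le\gamma\le\tau_{\|\cdot\|}$ (it is Hausdorff locally convex). $(X,\|\cdot\|,\tau)$ is a Saks space if there is a directed system of seminorms $\mathcal{P}_\tau$ generating $\tau$ with $\|x\|=\sup_{p\in\mathcal{P}_\tau}p(x)$ for all $x\in X$; it is sequentially complete if $(X,\gamma)$ is sequentially complete; it is Mazur (a Mazur--Saks space) if every linear $\gamma$-sequentially continuous functional on $X$ is $\gamma$-continuous. $X^{\circ}=\{x'\in X' : x' \text{ is } \tau\text{-sequentially continuous on } \|\cdot\|\text{-bounded sets}\}$, a closed subspace of $X'$. $(X,\|\cdot\|,\tau)$ is d-consistent if (i) $X^{\circ}\cap\{x'\in X':\|x'\|_{X'}\le1\}$ is sequentially complete w.r.t. $\sigma(X^{\circ},X)$, and (ii) every $\|\cdot\|_{X'}$-bounded $\sigma(X^{\circ},X)$-null sequence in $X^{\circ}$ is $\tau$-equicontinuous on $\|\cdot\|$-bounded sets (i.e. its restriction to every $\|\cdot\|$-bounded set $B$ is equicontinuous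 for the topology induced by $\tau$ on $B$). A bi-continuous semigroup on $X$ is a family $(T(t))_{t\ge0}$ in $\mathcal{L}(X)$ with $T(0)=\mathrm{id}$, $T(t+s)=T(t)T(s)$; $t\mapsto T(t)x\in(X,\gamma)$ continuous on $[0,\infty)$ for every $x\in X$; and, whenever $x_n\to x$ in $(X,\gamma)$, $T(t)(x_n-x)\to0$ in $(X,\gamma)$ locally uniformly in $t\in[0,\infty)$. Its generator is $Ax=\gamma\text{-}\lim_{t\to0+}\frac{T(t)x-x}{t}$ with $D(A)$ the set of $x\in X$ for which this limit exists in $X$. $\rho(A)$ is the set of scalars $\lambda$ such that $\lambda-A\colon D(A)\to X$ is bijective with $R(\lambda,A)=(\lambda-A)^{-1}\in\mathcal{L}(X)$. The dual operators $T(t)'$ leave $X^\circ$ invariant; $T^{\circ}(t)=T(t)'|_{X^{\circ}}$. The bi-sun dual is $X^{\bullet}=\{x^{\circ}\in X^{\circ} : \lim_{t\to0+}\|T^{\circ}(t)x^{\circ}-x^{\circ}\|_{X'}=0\}$, a norm-closed $T^\circ$-invariant subspace; $T^{\bullet}(t)=T^{\circ}(t)|_{X^{\bullet}}$ is a norm-strongly continuous semigroup on $X^\bullet$ with generator $(A^{\bullet},D(A^{\bullet}))$. For $\lambda\in\rho(A)$, $R(\lambda,A)^{\bullet}=R(\lambda,A)'|_{X^{\bullet}}$ (restriction of the Banach space adjoint). The Favard space is $Fav(T)=\{x\in X : \limsup_{t\to0+}\frac1t\|T(t)x-x\|<\infty\}$. *)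

theory Defs
  imports "HOL-Analysis.Analysis"
begin

text \<open>The scalar field is \<open>\<real>\<close> or \<open>\<complex>\<close>: up to isometric isomorphism these are the only
  instances of the following class. The two disjuncts are the real and the complex case.\<close>

class real_or_complex = real_normed_field +
  assumes real_or_complex:
    "(\<forall>z. \<exists>a. z = a *\<^sub>R 1) \<or>
     (\<exists>i. i * i = - 1 \<and> (\<forall>z. \<exists>a b. z = a *\<^sub>R 1 + b *\<^sub>R i) \<and>
          (\<forall>a b. norm (a *\<^sub>R 1 + b *\<^sub>R i) = sqrt (a\<^sup>2 + b\<^sup>2)))"

instance real :: real_or_complex
  by standard simp

instance complex :: real_or_complex
proof
  have "\<exists>a b. z = a *\<^sub>R 1 + b *\<^sub>R \<i>" for z :: complex
    by (intro exI[of _ "Re z"] exI[of _ "Im z"]) (simp add: complex_eq_iff)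
  moreover have "norm (a *\<^sub>R 1 + b *\<^sub>R \<i>) = sqrt (a\<^sup>2 + b\<^sup>2)" for a b
    by (simp add: cmod_def)
  ultimately show "(\<forall>z::complex. \<exists>a. z = a *\<^sub>R 1) \<or>
     (\<exists>i::complex. i * i = - 1 \<and> (\<forall>z. \<exists>a b. z = a *\<^sub>R 1 + b *\<^sub>R i) \<and>
          (\<forall>a b. norm (a *\<^sub>R 1 + b *\<^sub>R i) = sqrt (a\<^sup>2 + b\<^sup>2)))"
    by (intro disjI2 exI[of _ \<i>]) auto
qed

text \<open>A Banach space over \<open>'k\<close> is a type of class \<^class>\<open>banach\<close> (the underlying real Banach space)
  together with a compatible scalar multiplication by \<open>'k\<close>.\<close>

locale banach_space_over = vector_space smul
  for smul :: "'k::real_or_complex \<Rightarrow> 'a::banach \<Rightarrow> 'a" +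
  assumes scale_of_real: "smul (of_real r) x = r *\<^sub>R x"
    and norm_scale: "norm (smul c x) = norm c * norm x"

text \<open>The norm of \<^typ>\<open>'a \<Rightarrow>\<^sub>L 'k\<close> is the operator norm, so \<open>norm_dual\<close> and \<open>bounded_ops\<close>
  carry the dual norm and the operator norm, respectively.\<close>

definition norm_dual ::
  "('k::real_or_complex \<Rightarrow> 'a::banach \<Rightarrow> 'a) \<Rightarrow> ('a \<Rightarrow>\<^sub>L 'k) set" where
  "norm_dual smul = {f. Vector_Spaces.linear smul (*) (blinfun_apply f)}"

definition bounded_ops ::
  "('k::real_or_complex \<Rightarrow> 'a::banach \<Rightarrow> 'a) \<Rightarrow> ('a \<Rightarrow>\<^sub>L 'a) set" where
  "bounded_ops smul = {S. Vector_Spaces.linear smul smul (blinfun_apply S)}"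

definition adjoint_op ::
  "('a::real_normed_vector \<Rightarrow>\<^sub>L 'a) \<Rightarrow> ('a \<Rightarrow>\<^sub>L 'k::real_normed_vector) \<Rightarrow> ('a \<Rightarrow>\<^sub>L 'k)" where
  "adjoint_op S f = f o\<^sub>L S"


definition coarser_eq :: "'a topology \<Rightarrow> 'a topology \<Rightarrow> bool" where
  "coarser_eq S T \<longleftrightarrow> (\<forall>U. openin S U \<longrightarrow> openin T U)"

definition linear_topology ::
  "('k::real_or_complex \<Rightarrow> 'a::banach \<Rightarrow> 'a) \<Rightarrow> 'a topology \<Rightarrow> bool" where
  "linear_topology smul T \<longleftrightarrow>
     topspace T = UNIV \<and>
     continuous_map (prod_topology T T) T (\<lambda>(x, y). x + y) \<and>
     continuous_map (prod_topology euclidean T) T (\<lambda>(c, x). smul c x)"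

definition locally_convex_topology ::
  "('k::real_or_complex \<Rightarrow> 'a::banach \<Rightarrow> 'a) \<Rightarrow> 'a topology \<Rightarrow> bool" where
  "locally_convex_topology smul T \<longleftrightarrow>
     linear_topology smul T \<and>
     (\<forall>U. openin T U \<and> 0 \<in> U \<longrightarrow> (\<exists>V. openin T V \<and> 0 \<in> V \<and> convex V \<and> V \<subseteq> U))"

definition seminorm_over ::
  "('k::real_or_complex \<Rightarrow> 'a::banach \<Rightarrow> 'a) \<Rightarrow> ('a \<Rightarrow> real) \<Rightarrow> bool" where
  "seminorm_over smul p \<longleftrightarrow>
     (\<forall>x. 0 \<le> p x) \<and> (\<forall>x y. p (x + y) \<le> p x + p y) \<and> (\<forall>c x. p (smul c x) = norm c * p x)"

definition directed_seminorms ::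
  "('k::real_or_complex \<Rightarrow> 'a::banach \<Rightarrow> 'a) \<Rightarrow> ('a \<Rightarrow> real) set \<Rightarrow> bool" where
  "directed_seminorms smul P \<longleftrightarrow>
     P \<noteq> {} \<and> (\<forall>p\<in>P. seminorm_over smul p) \<and>
     (\<forall>p\<in>P. \<forall>q\<in>P. \<exists>r\<in>P. \<forall>x. p x \<le> r x \<and> q x \<le> r x)"

definition seminorm_topology :: "('a::banach \<Rightarrow> real) set \<Rightarrow> 'a topology" where
  "seminorm_topology P =
     topology_generated_by {{y. p (y - x) < e} | p x e. p \<in> P \<and> 0 < e}"

definition saks_space ::
  "('k::real_or_complex \<Rightarrow> 'a::banach \<Rightarrow> 'a) \<Rightarrow> 'a topology \<Rightarrow> bool" where
  "saks_space smul \<tau> \<longleftrightarrow>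
     banach_space_over smul \<and>
     locally_convex_topology smul \<tau> \<and> Hausdorff_space \<tau> \<and> coarser_eq \<tau> euclidean \<and>
     (\<exists>P. directed_seminorms smul P \<and> \<tau> = seminorm_topology P \<and>
          (\<forall>x. bdd_above ((\<lambda>p. p x) ` P) \<and> norm x = (SUP p\<in>P. p x)))"

definition mixed_candidate ::
  "('k::real_or_complex \<Rightarrow> 'a::banach \<Rightarrow> 'a) \<Rightarrow> 'a topology \<Rightarrow> 'a topology \<Rightarrow> bool" where
  "mixed_candidate smul \<tau> \<sigma> \<longleftrightarrow>
     linear_topology smul \<sigma> \<and> coarser_eq \<tau> \<sigma> \<and> coarser_eq \<sigma> euclidean \<and>
     (\<forall>B. bounded B \<longrightarrow> subtopology \<sigma> B = subtopology \<tau> B)"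

text \<open>\<open>is_mixed_topology smul \<tau> \<gamma>\<close>: \<open>\<gamma>\<close> is the (necessarily unique) finest candidate.\<close>

definition is_mixed_topology ::
  "('k::real_or_complex \<Rightarrow> 'a::banach \<Rightarrow> 'a) \<Rightarrow> 'a topology \<Rightarrow> 'a topology \<Rightarrow> bool" where
  "is_mixed_topology smul \<tau> \<gamma> \<longleftrightarrow>
     mixed_candidate smul \<tau> \<gamma> \<and> (\<forall>\<sigma>. mixed_candidate smul \<tau> \<sigma> \<longrightarrow> coarser_eq \<sigma> \<gamma>)"

text \<open>Cauchy sequences with respect to the uniformity of a group topology \<open>T\<close> on a subgroup
  of the type.\<close>

definition top_Cauchy :: "'b::ab_group_add topology \<Rightarrow> (nat \<Rightarrow> 'b) \<Rightarrow> bool" where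
  "top_Cauchy T u \<longleftrightarrow>
     (\<forall>U. openin T U \<and> 0 \<in> U \<longrightarrow> (\<exists>N. \<forall>m\<ge>N. \<forall>n\<ge>N. u m - u n \<in> U))"

definition seq_complete_on :: "'b::ab_group_add topology \<Rightarrow> 'b set \<Rightarrow> bool" where
  "seq_complete_on T S \<longleftrightarrow>
     (\<forall>u. range u \<subseteq> S \<and> top_Cauchy T u \<longrightarrow> (\<exists>l\<in>S. limitin T u l sequentially))"

definition mazur_saks ::
  "('k::real_or_complex \<Rightarrow> 'a::banach \<Rightarrow> 'a) \<Rightarrow> 'a topology \<Rightarrow> bool" where
  "mazur_saks smul \<gamma> \<longleftrightarrow>
     (\<forall>f. Vector_Spaces.linear smul (*) f \<and>
          (\<forall>u l. limitin \<gamma> u l sequentially \<longrightarrow> (\<lambda>n. f (u n)) \<longlonglongrightarrow> f l)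
          \<longrightarrow> continuous_map \<gamma> euclidean f)"


definition circ_dual ::
  "('k::real_or_complex \<Rightarrow> 'a::banach \<Rightarrow> 'a) \<Rightarrow> 'a topology \<Rightarrow> ('a \<Rightarrow>\<^sub>L 'k) set" where
  "circ_dual smul \<tau> =
     {f \<in> norm_dual smul.
        \<forall>B. bounded B \<longrightarrow>
          (\<forall>u l. range u \<subseteq> B \<and> l \<in> B \<and> limitin \<tau> u l sequentially
                  \<longrightarrow> (\<lambda>n. blinfun_apply f (u n)) \<longlonglongrightarrow> blinfun_apply f l)}"

text \<open>The topology \<open>\<sigma>(F, X)\<close> of pointwise convergence on a space \<open>F\<close> of functionals.\<close>

definition weak_star_topology ::
  "('a::real_normed_vector \<Rightarrow>\<^sub>L 'k::real_normed_vector) set \<Rightarrow> ('a \<Rightarrow>\<^sub>L 'k) topology" where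
  "weak_star_topology F =
     pullback_topology F blinfun_apply (product_topology (\<lambda>_. euclidean) UNIV)"

definition equicontinuous_on_bounded ::
  "'a::real_normed_vector topology \<Rightarrow> (nat \<Rightarrow> ('a \<Rightarrow>\<^sub>L 'k::real_normed_vector)) \<Rightarrow> bool" where
  "equicontinuous_on_bounded \<tau> f \<longleftrightarrow>
     (\<forall>B. bounded B \<longrightarrow>
       (\<forall>x\<in>B. \<forall>e>0. \<exists>U. openin (subtopology \<tau> B) U \<and> x \<in> U \<and>
          (\<forall>y\<in>U. \<forall>n. norm (blinfun_apply (f n) y - blinfun_apply (f n) x) < e)))"

definition d_consistent ::
  "('k::real_or_complex \<Rightarrow> 'a::banach \<Rightarrow> 'a) \<Rightarrow> 'a topology \<Rightarrow> bool" where
  "d_consistent smul \<tau> \<longleftrightarrow>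
     seq_complete_on (weak_star_topology (circ_dual smul \<tau>))
       (circ_dual smul \<tau> \<inter> {f \<in> norm_dual smul. norm f \<le> 1}) \<and>
     (\<forall>f. range f \<subseteq> circ_dual smul \<tau> \<and> bounded (range f) \<and>
          limitin (weak_star_topology (circ_dual smul \<tau>)) f 0 sequentially
          \<longrightarrow> equicontinuous_on_bounded \<tau> f)"


text \<open>A semigroup is indexed by \<^typ>\<open>real\<close>; only its values at times \<open>t \<ge> 0\<close> matter.\<close>

definition bicontinuous_semigroup ::
  "('k::real_or_complex \<Rightarrow> 'a::banach \<Rightarrow> 'a) \<Rightarrow> 'a topology \<Rightarrow> (real \<Rightarrow> ('a \<Rightarrow>\<^sub>L 'a)) \<Rightarrow> bool" where
  "bicontinuous_semigroup smul \<gamma> T \<longleftrightarrow>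
     (\<forall>t\<ge>0. T t \<in> bounded_ops smul) \<and>
     T 0 = id_blinfun \<and>
     (\<forall>t\<ge>0. \<forall>s\<ge>0. T (t + s) = T t o\<^sub>L T s) \<and>
     (\<forall>x. continuous_map (top_of_set {0..}) \<gamma> (\<lambda>t. blinfun_apply (T t) x)) \<and>
     (\<forall>u x. limitin \<gamma> u x sequentially \<longrightarrow>
       (\<forall>b\<ge>0. \<forall>U. openin \<gamma> U \<and> 0 \<in> U \<longrightarrow>
          (\<exists>N. \<forall>n\<ge>N. \<forall>t\<in>{0..b}. blinfun_apply (T t) (u n - x) \<in> U)))"

text \<open>Generator of a one-parameter family \<open>S\<close> on a subspace \<open>Y\<close> carrying the topology \<open>\<theta>\<close>:
  its domain and its action (meaningful on the domain when \<open>\<theta>\<close> is Hausdorff).\<close>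

definition generator_dom ::
  "'b::real_vector topology \<Rightarrow> 'b set \<Rightarrow> (real \<Rightarrow> 'b \<Rightarrow> 'b) \<Rightarrow> 'b set" where
  "generator_dom \<theta> Y S =
     {x \<in> Y. \<exists>y\<in>Y. limitin \<theta> (\<lambda>t. (1 / t) *\<^sub>R (S t x - x)) y (at_right 0)}"

definition generator_op ::
  "'b::real_vector topology \<Rightarrow> 'b set \<Rightarrow> (real \<Rightarrow> 'b \<Rightarrow> 'b) \<Rightarrow> 'b \<Rightarrow> 'b" where
  "generator_op \<theta> Y S x =
     (THE y. y \<in> Y \<and> limitin \<theta> (\<lambda>t. (1 / t) *\<^sub>R (S t x - x)) y (at_right 0))"

text \<open>Resolvent set and resolvents of an operator \<open>A\<close> with domain \<open>D\<close>.\<close>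

definition resolvent_set ::
  "('k::real_or_complex \<Rightarrow> 'a::banach \<Rightarrow> 'a) \<Rightarrow> 'a set \<Rightarrow> ('a \<Rightarrow> 'a) \<Rightarrow> 'k set" where
  "resolvent_set smul D A =
     {\<mu>. bij_betw (\<lambda>x. smul \<mu> x - A x) D UNIV \<and>
         (\<exists>R\<in>bounded_ops smul. blinfun_apply R = inv_into D (\<lambda>x. smul \<mu> x - A x))}"

definition resolvent ::
  "('k::real_or_complex \<Rightarrow> 'a::banach \<Rightarrow> 'a) \<Rightarrow> 'a set \<Rightarrow> ('a \<Rightarrow> 'a) \<Rightarrow> 'k \<Rightarrow> ('a \<Rightarrow>\<^sub>L 'a)" where
  "resolvent smul D A \<mu> = Blinfun (inv_into D (\<lambda>x. smul \<mu> x - A x))"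

definition semigroup_dom :: "'a::banach topology \<Rightarrow> (real \<Rightarrow> ('a \<Rightarrow>\<^sub>L 'a)) \<Rightarrow> 'a set" where
  "semigroup_dom \<gamma> T = generator_dom \<gamma> UNIV (\<lambda>t. blinfun_apply (T t))"

definition semigroup_gen :: "'a::banach topology \<Rightarrow> (real \<Rightarrow> ('a \<Rightarrow>\<^sub>L 'a)) \<Rightarrow> 'a \<Rightarrow> 'a" where
  "semigroup_gen \<gamma> T = generator_op \<gamma> UNIV (\<lambda>t. blinfun_apply (T t))"

definition semigroup_resolvent_set ::
  "('k::real_or_complex \<Rightarrow> 'a::banach \<Rightarrow> 'a) \<Rightarrow> 'a topology \<Rightarrow> (real \<Rightarrow> ('a \<Rightarrow>\<^sub>L 'a)) \<Rightarrow> 'k set" where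
  "semigroup_resolvent_set smul \<gamma> T =
     resolvent_set smul (semigroup_dom \<gamma> T) (semigroup_gen \<gamma> T)"

definition semigroup_resolvent ::
  "('k::real_or_complex \<Rightarrow> 'a::banach \<Rightarrow> 'a) \<Rightarrow> 'a topology \<Rightarrow> (real \<Rightarrow> ('a \<Rightarrow>\<^sub>L 'a)) \<Rightarrow>
   'k \<Rightarrow> ('a \<Rightarrow>\<^sub>L 'a)" where
  "semigroup_resolvent smul \<gamma> T =
     resolvent smul (semigroup_dom \<gamma> T) (semigroup_gen \<gamma> T)"

definition bi_sun_dual ::
  "('k::real_or_complex \<Rightarrow> 'a::banach \<Rightarrow> 'a) \<Rightarrow> 'a topology \<Rightarrow> (real \<Rightarrow> ('a \<Rightarrow>\<^sub>L 'a)) \<Rightarrow>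
   ('a \<Rightarrow>\<^sub>L 'k) set" where
  "bi_sun_dual smul \<tau> T =
     {f \<in> circ_dual smul \<tau>. ((\<lambda>t. norm (adjoint_op (T t) f - f)) \<longlongrightarrow> 0) (at_right 0)}"

text \<open>The domain of the generator of the bi-sun dual semigroup; \<^const>\<open>euclidean\<close> is the topology
  of the dual norm.\<close>

definition bi_sun_generator_dom ::
  "('k::real_or_complex \<Rightarrow> 'a::banach \<Rightarrow> 'a) \<Rightarrow> 'a topology \<Rightarrow> (real \<Rightarrow> ('a \<Rightarrow>\<^sub>L 'a)) \<Rightarrow>
   ('a \<Rightarrow>\<^sub>L 'k) set" where
  "bi_sun_generator_dom smul \<tau> T =
     generator_dom euclidean (bi_sun_dual smul \<tau> T) (\<lambda>t. adjoint_op (T t))"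

definition Lambda_set ::
  "('k::real_or_complex \<Rightarrow> 'a::banach \<Rightarrow> 'a) \<Rightarrow> 'a topology \<Rightarrow> 'a topology \<Rightarrow>
   (real \<Rightarrow> ('a \<Rightarrow>\<^sub>L 'a)) \<Rightarrow> 'k set" where
  "Lambda_set smul \<tau> \<gamma> T =
     {\<mu> \<in> semigroup_resolvent_set smul \<gamma> T.
        adjoint_op (semigroup_resolvent smul \<gamma> T \<mu>) ` bi_sun_dual smul \<tau> T
          \<subseteq> bi_sun_generator_dom smul \<tau> T}"

definition Fav :: "(real \<Rightarrow> ('a::banach \<Rightarrow>\<^sub>L 'a)) \<Rightarrow> 'a set" where
  "Fav T = {x. Limsup (at_right 0) (\<lambda>t. ereal (1 / t * norm (blinfun_apply (T t) x - x))) < \<infinity>}"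

end

theory Submission
  imports Defs
begin

text \<open>Everything is reduced to sequences. In a Saks space whose topology \<open>\<tau>\<close> is generated by a directed
  system \<open>P\<close> of seminorms with supremum \<open>norm\<close>, a sequence converges for the mixed topology \<open>\<gamma>\<close> iff it
  is norm bounded and converges in every \<open>p \<in> P\<close> (lemma \<open>limitin_gamma\<close>). Boundedness is the point of
  that lemma: along an unbounded sequence some seminorm \<open>q = SUP p_k / (k + 1)\<close> with \<open>p_k \<in> P\<close> is
  unbounded, while adjoining \<open>q\<close> to \<open>P\<close> does not change \<open>\<tau>\<close> on bounded sets, so that \<open>q\<close> is
  \<open>\<gamma>\<close>-continuous. From then on only the pair (norm, \<open>P\<close>) is used, and the norm is lower semicontinuous
  for this convergence.

  By sequential completeness each orbit has Riemann integrals \<open>I t x = \<integral> T s x ds\<close> over \<open>[0, t]\<close>. They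
  satisfy \<open>A (I t x) = T t x - x\<close>, and \<open>I t (A x) = T t x - x\<close> on the domain of the generator \<open>A\<close>. Let
  \<open>R = R(\<mu>, A)\<close>, and let \<open>J h = I h / h\<close> be the mean of the orbit over \<open>[0, h]\<close>. The first identity says
  that \<open>J h = R B\<close> for the operator \<open>B = \<mu> J h - (T h - 1) / h\<close>, which is sequentially \<open>\<gamma>\<close>-continuous and
  commutes with \<open>R\<close>.

  (i) implies (ii): if the difference quotients of the orbit of \<open>x\<close> at \<open>0\<close> are bounded, then so are the
  \<open>y n = B x\<close> for a sequence \<open>h n\<close> tending to \<open>0\<close>, and \<open>R (y n) = J (h n) x\<close> tends to \<open>x\<close>. (ii) implies
  (iii) with \<open>k = 0\<close>.

  (iii) implies (i): applying \<open>B\<close> to the power \<open>k\<close> cancels \<open>k\<close> resolvents, so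
  \<open>(J h)^k R (y n)\<close> tends to \<open>(J h)^k x\<close> as \<open>n\<close> grows. Since \<open>A R (y n) = \<mu> R (y n) - y n\<close> is bounded, the
  second identity gives \<open>norm ((T t - 1) R (y n)) \<le> C t\<close>, and the operators \<open>J h\<close> are uniformly bounded.
  Lower semicontinuity turns this into \<open>norm ((J h)^k (T t - 1) x) \<le> C' t\<close> with \<open>C'\<close> independent of \<open>h\<close>,
  and once more, for \<open>h\<close> tending to \<open>0\<close>, into \<open>norm (T t x - x) \<le> C' t\<close>.

  Passing from "all" to "some" requires \<open>\<Lambda>\<close> to be nonempty. For real \<open>c\<close> so large that
  \<open>S = exp (- c) T 1\<close> has norm below \<open>1\<close>, the identities above for the rescaled semigroup
  \<open>exp (- c t) T t\<close> show that the integral over \<open>[0, 1]\<close> composed with the Neumann inverse of \<open>1 - S\<close> is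
  the resolvent at \<open>c\<close>; and for \<open>f\<close> in the bi-sun dual the difference quotients of \<open>R' f\<close> converge in norm
  to \<open>c R' f - f\<close>, because at \<open>y\<close> they differ from it by the mean over \<open>s \<le> t\<close> of the values of
  \<open>T(s)' f - f\<close> at the fixed vector \<open>c R y - y\<close>.\<close>

section \<open>Seminorms over the reals\<close>

definition real_seminorm :: "('a::real_vector \<Rightarrow> real) \<Rightarrow> bool" where
  "real_seminorm q \<longleftrightarrow>
     (\<forall>x y. q (x + y) \<le> q x + q y) \<and> (\<forall>a x. q (a *\<^sub>R x) = \<bar>a\<bar> * q x)"

lemma real_seminorm_add: "real_seminorm q \<Longrightarrow> q (x + y) \<le> q x + q y"
  and real_seminorm_scale: "real_seminorm q \<Longrightarrow> q (a *\<^sub>R x) = \<bar>a\<bar> * q x"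
  by (simp_all add: real_seminorm_def)

lemma real_seminorm_zero: "real_seminorm q \<Longrightarrow> q 0 = 0"
  using real_seminorm_scale[of q 0 0] by simp

lemma real_seminorm_minus: "real_seminorm q \<Longrightarrow> q (- x) = q x"
  using real_seminorm_scale[of q "- 1" x] by simp

lemma real_seminorm_diff: "real_seminorm q \<Longrightarrow> q (x - y) \<le> q x + q y"
  using real_seminorm_add[of q x "- y"] real_seminorm_minus[of q y] by simp

lemma real_seminorm_nonneg: "real_seminorm q \<Longrightarrow> 0 \<le> q x"
  using real_seminorm_diff[of q x x] real_seminorm_zero[of q] by simp

lemma real_seminorm_swap: "real_seminorm q \<Longrightarrow> q (x - y) = q (y - x)"
  using real_seminorm_minus[of q "x - y"] by simp

lemma real_seminorm_triangle: "real_seminorm q \<Longrightarrow> q (x - z) \<le> q (x - y) + q (y - z)"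
  using real_seminorm_add[of q "x - y" "y - z"] by simp

lemma real_seminorm_sum:
  assumes "real_seminorm q"
  shows "q (sum f A) \<le> (\<Sum>i\<in>A. q (f i))"
proof (induction A rule: infinite_finite_induct)
  case (insert i A)
  then show ?case
    using real_seminorm_add[OF assms, of "f i" "sum f A"] by simp
qed (simp_all add: real_seminorm_zero[OF assms])

lemma real_seminorm_sum_bound:
  assumes "real_seminorm q" "\<And>i. i \<in> A \<Longrightarrow> q (f i) \<le> e"
  shows "q (sum f A) \<le> real (card A) * e"
  using real_seminorm_sum[OF assms(1), of f A] sum_bounded_above[of A "\<lambda>i. q (f i)" e] assms(2)
  by force

section \<open>Bounded convergence with respect to a norming family of seminorms\<close>

text \<open>The sequential shadow of a sequentially complete Saks space: a family of seminorms with supremum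
  \<open>norm\<close> such that norm-bounded sequences which are Cauchy for all of them converge. Only real scalars
  occur, so both scalar fields are treated at once.\<close>
locale norming_seminorms =
  fixes P :: "('a::banach \<Rightarrow> real) set"
  assumes seminorm: "p \<in> P \<Longrightarrow> real_seminorm p"
    and le_norm: "p \<in> P \<Longrightarrow> p x \<le> norm x"
    and norm_leI: "(\<And>p. p \<in> P \<Longrightarrow> p x \<le> c) \<Longrightarrow> norm x \<le> c"
    and complete: "bounded (range u) \<Longrightarrow>
      (\<And>p e. p \<in> P \<Longrightarrow> 0 < e \<Longrightarrow> \<exists>N. \<forall>m\<ge>N. \<forall>n\<ge>N. p (u m - u n) < e) \<Longrightarrow>
      \<exists>l. \<forall>p\<in>P. (\<lambda>n. p (u n - l)) \<longlonglongrightarrow> 0"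
begin

text \<open>For a Saks space this is sequential convergence in the mixed topology.\<close>
definition conv :: "(nat \<Rightarrow> 'a) \<Rightarrow> 'a \<Rightarrow> bool" where
  "conv u l \<longleftrightarrow> bounded (range u) \<and> (\<forall>p\<in>P. (\<lambda>n. p (u n - l)) \<longlonglongrightarrow> 0)"

lemma conv_bounded: "conv u l \<Longrightarrow> bounded (range u)"
  by (simp add: conv_def)

lemma conv_seminorm: "conv u l \<Longrightarrow> p \<in> P \<Longrightarrow> (\<lambda>n. p (u n - l)) \<longlonglongrightarrow> 0"
  by (simp add: conv_def)

lemma null_seminorm: "conv u 0 \<Longrightarrow> p \<in> P \<Longrightarrow> (\<lambda>n. p (u n)) \<longlonglongrightarrow> 0"
  using conv_seminorm by fastforce

lemma seminorm_null_le:
  assumes "p \<in> P" "(\<lambda>n. g n) \<longlonglongrightarrow> (0::real)" "\<And>n. p (u n) \<le> g n"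
  shows "(\<lambda>n. p (u n)) \<longlonglongrightarrow> 0"
  by (rule tendsto_sandwich[OF _ _ tendsto_const assms(2)])
    (use assms real_seminorm_nonneg[OF seminorm] in auto)

lemma norm_tendsto_imp_conv:
  assumes "u \<longlonglongrightarrow> l"
  shows "conv u l"
  unfolding conv_def
proof (intro conjI ballI)
  show "bounded (range u)"
    using assms convergent_imp_bounded by blast
  fix p assume "p \<in> P"
  then show "(\<lambda>n. p (u n - l)) \<longlonglongrightarrow> 0"
    using le_norm[OF \<open>p \<in> P\<close>] tendsto_norm_zero[OF LIM_zero[OF assms]]
    by - (rule seminorm_null_le[where u = "\<lambda>n. u n - l"], simp_all)
qed

lemma conv_const: "conv (\<lambda>_. l) l"
  by (simp add: norm_tendsto_imp_conv)

lemma conv_add: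
  assumes "conv u l" "conv v m"
  shows "conv (\<lambda>n. u n + v n) (l + m)"
  unfolding conv_def
proof (intro conjI ballI)
  show "bounded (range (\<lambda>n. u n + v n))"
    using assms by (intro bounded_plus_comp conv_bounded)
  fix p assume p: "p \<in> P"
  have "(\<lambda>n. p (u n - l) + p (v n - m)) \<longlonglongrightarrow> 0 + 0"
    by (intro tendsto_add conv_seminorm assms p)
  moreover have "p (u n + v n - (l + m)) \<le> p (u n - l) + p (v n - m)" for n
    using real_seminorm_add[OF seminorm[OF p]] by (simp add: add_diff_add)
  ultimately show "(\<lambda>n. p (u n + v n - (l + m))) \<longlonglongrightarrow> 0"
    by - (rule seminorm_null_le[where u = "\<lambda>n. u n + v n - (l + m)", OF p], simp_all)
qed

lemma conv_scaleR_var: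
  assumes "conv u l" "a \<longlonglongrightarrow> c"
  shows "conv (\<lambda>n. a n *\<^sub>R u n) (c *\<^sub>R l)"
  unfolding conv_def
proof (intro conjI ballI)
  obtain A where A: "norm (a n) \<le> A" for n
    using convergent_imp_bounded[OF assms(2)] by (auto simp: bounded_iff)
  obtain U where U: "norm (u n) \<le> U" for n
    using conv_bounded[OF assms(1)] by (auto simp: bounded_iff)
  have A0: "0 \<le> A" using A[of 0] norm_ge_zero order_trans by blast
  show "bounded (range (\<lambda>n. a n *\<^sub>R u n))"
    using A U A0 by (auto simp: bounded_iff intro!: exI[of _ "A * U"] mult_mono)
  fix p assume p: "p \<in> P"
  note s = seminorm[OF p]
  have "(\<lambda>n. A * p (u n - l) + \<bar>a n - c\<bar> * p l) \<longlonglongrightarrow> A * 0 + 0 * p l"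
    by (intro tendsto_intros conv_seminorm[OF assms(1) p] tendsto_rabs_zero)
      (use assms(2) LIM_zero_iff in blast)
  moreover have "p (a n *\<^sub>R u n - c *\<^sub>R l) \<le> A * p (u n - l) + \<bar>a n - c\<bar> * p l" for n
  proof -
    have "p (a n *\<^sub>R u n - c *\<^sub>R l) = p (a n *\<^sub>R (u n - l) + (a n - c) *\<^sub>R l)"
      by (simp add: algebra_simps)
    also have "\<dots> \<le> \<bar>a n\<bar> * p (u n - l) + \<bar>a n - c\<bar> * p l"
      using real_seminorm_add[OF s] by (metis real_seminorm_scale[OF s])
    also have "\<dots> \<le> A * p (u n - l) + \<bar>a n - c\<bar> * p l"
      using A[of n] real_seminorm_nonneg[OF s] by (auto intro!: mult_right_mono)
    finally show ?thesis .
  qed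
  ultimately show "(\<lambda>n. p (a n *\<^sub>R u n - c *\<^sub>R l)) \<longlonglongrightarrow> 0"
    by - (rule seminorm_null_le[where u = "\<lambda>n. a n *\<^sub>R u n - c *\<^sub>R l", OF p], simp_all)
qed

lemma conv_scaleR: "conv u l \<Longrightarrow> conv (\<lambda>n. c *\<^sub>R u n) (c *\<^sub>R l)"
  by (simp add: conv_scaleR_var)

lemma conv_diff:
  assumes "conv u l" "conv v m"
  shows "conv (\<lambda>n. u n - v n) (l - m)"
  using conv_add[OF assms(1) conv_scaleR[OF assms(2), of "-1"]] by simp

lemma conv_null_iff: "conv (\<lambda>n. u n - l) 0 \<longleftrightarrow> conv u l"
  using conv_add[of "\<lambda>n. u n - l" 0 "\<lambda>_. l" l] conv_diff[of u l "\<lambda>_. l" l] conv_const[of l]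
  by auto

lemma seminorm_lsc:
  assumes q: "real_seminorm q" "(\<lambda>n. q (u n - l)) \<longlonglongrightarrow> 0" and b: "b \<longlonglongrightarrow> c" "\<And>n. q (u n) \<le> b n"
  shows "q l \<le> c"
proof (rule LIMSEQ_le_const)
  show "(\<lambda>n. q (u n - l) + b n) \<longlonglongrightarrow> c"
    using tendsto_add[OF q(2) b(1)] by simp
  have "q l \<le> q (u n - l) + b n" for n
    using real_seminorm_diff[OF q(1), of "u n" "u n - l"] b(2)[of n] by simp
  then show "\<exists>N. \<forall>n\<ge>N. q l \<le> q (u n - l) + b n" by blast
qed

text \<open>The norm is a supremum of seminorms that are continuous for \<^const>\<open>conv\<close>.\<close>
lemma norm_lsc:
  assumes "conv u l" "\<And>n. norm (u n) \<le> c"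
  shows "norm l \<le> c"
proof (rule norm_leI)
  fix p assume p: "p \<in> P"
  show "p l \<le> c"
    by (rule seminorm_lsc[OF seminorm[OF p] conv_seminorm[OF assms(1) p] tendsto_const])
      (use le_norm[OF p] assms(2) order_trans in blast)
qed

lemma conv_unique:
  assumes "conv u l" "conv u m"
  shows "l = m"
proof -
  have "conv (\<lambda>n. 0) (l - m)"
    using conv_diff[OF assms] by simp
  then have "norm (l - m) \<le> 0"
    by (rule norm_lsc) simp
  then show ?thesis by simp
qed

lemma completeE:
  assumes "bounded (range u)"
    and "\<And>p e. p \<in> P \<Longrightarrow> 0 < e \<Longrightarrow> \<exists>N. \<forall>m\<ge>N. \<forall>n\<ge>N. p (u m - u n) < e"
  obtains l where "conv u l"
  using complete[OF assms] assms(1) unfolding conv_def by blast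

definition conv_cont :: "('a \<Rightarrow> 'a) \<Rightarrow> bool" where
  "conv_cont L \<longleftrightarrow> linear L \<and> (\<forall>u l. conv u l \<longrightarrow> conv (\<lambda>n. L (u n)) (L l))"

lemma conv_cont_linear: "conv_cont L \<Longrightarrow> linear L"
  and conv_cont_conv: "conv_cont L \<Longrightarrow> conv u l \<Longrightarrow> conv (\<lambda>n. L (u n)) (L l)"
  by (simp_all add: conv_cont_def)

lemma conv_contI_null:
  assumes "linear L" "\<And>u. conv u 0 \<Longrightarrow> conv (\<lambda>n. L (u n)) 0"
  shows "conv_cont L"
  unfolding conv_cont_def
proof (intro conjI allI impI assms(1))
  fix u l assume "conv u l"
  then have "conv (\<lambda>n. L (u n - l)) 0"
    by (intro assms(2)) (simp add: conv_null_iff)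
  then show "conv (\<lambda>n. L (u n)) (L l)"
    by (simp add: linear_diff[OF assms(1)] conv_null_iff)
qed

lemma conv_cont_scaleR: "conv_cont L \<Longrightarrow> conv_cont (\<lambda>x. c *\<^sub>R L x)"
  unfolding conv_cont_def by (auto intro: conv_scaleR linear_compose_scale_right)

lemma conv_cont_diff: "conv_cont L \<Longrightarrow> conv_cont M \<Longrightarrow> conv_cont (\<lambda>x. L x - M x)"
  unfolding conv_cont_def by (auto intro: conv_diff linear_compose_sub)

lemma conv_cont_compose: "conv_cont L \<Longrightarrow> conv_cont M \<Longrightarrow> conv_cont (\<lambda>x. L (M x))"
  unfolding conv_cont_def using linear_compose[of M L] by (auto simp: o_def)

lemma conv_cont_id: "conv_cont (\<lambda>x. x)"
  by (simp add: conv_cont_def linear_iff)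

lemma conv_cont_funpow: "conv_cont L \<Longrightarrow> conv_cont (L ^^ k)"
proof (induction k)
  case 0
  then show ?case using conv_cont_id by (simp add: id_def)
next
  case (Suc k)
  then show ?case using conv_cont_compose[of L "L ^^ k"] by (simp add: o_def)
qed

end

section \<open>Bi-continuous semigroups in sequential form\<close>

text \<open>Local bi-equicontinuity is expressed by sequences of times in a bounded interval, one time for each
  member of the null sequence; this is equivalent to uniformity in time.\<close>
locale seminorm_bicontinuous_semigroup = norming_seminorms P for P :: "('a::banach \<Rightarrow> real) set" +
  fixes T :: "real \<Rightarrow> ('a \<Rightarrow>\<^sub>L 'a)"
  assumes T_zero: "T 0 x = x"
    and T_add: "0 \<le> s \<Longrightarrow> 0 \<le> t \<Longrightarrow> T (s + t) x = T s (T t x)"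
    and orbit: "(\<And>n. 0 \<le> r n) \<Longrightarrow> r \<longlonglongrightarrow> t \<Longrightarrow> conv (\<lambda>n. T (r n) x) (T t x)"
    and unif: "conv u 0 \<Longrightarrow> (\<And>n. 0 \<le> r n \<and> r n \<le> b) \<Longrightarrow> conv (\<lambda>n. T (r n) (u n)) 0"
begin

lemma T_commute: "0 \<le> s \<Longrightarrow> 0 \<le> t \<Longrightarrow> T s (T t x) = T t (T s x)"
  using T_add[of s t x] T_add[of t s x] by (simp add: add.commute)

lemma linear_T: "linear (\<lambda>x. T t x)"
  by (simp add: linear_iff blinfun.add_right blinfun.scaleR_right)

lemma conv_cont_T: "0 \<le> t \<Longrightarrow> conv_cont (\<lambda>x. T t x)"
  using unif[of _ "\<lambda>_. t" t] by (intro conv_contI_null linear_T) auto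

lemma conv_T:
  assumes "conv u x" "\<And>n. 0 \<le> s n" "s \<longlonglongrightarrow> t"
  shows "conv (\<lambda>n. T (s n) (u n)) (T t x)"
proof -
  obtain b where "norm (s n) \<le> b" for n
    using convergent_imp_bounded[OF assms(3)] by (auto simp: bounded_iff)
  then have "conv (\<lambda>n. T (s n) (u n - x)) 0"
    using assms by (intro unif[where b=b]) (auto simp: conv_null_iff abs_le_iff)
  from conv_add[OF this orbit[OF assms(2,3), of x]] show ?thesis
    by (simp add: blinfun.diff_right)
qed

text \<open>Norm-null sequences are null for \<^const>\<open>conv\<close>, so bi-equicontinuity applies to them; if the operator
  norms were unbounded on \<open>[0, b]\<close>, some norm-null sequence would have unbounded images.\<close>
lemma T_bounded:
  obtains M where "0 \<le> M" "\<And>s. 0 \<le> s \<Longrightarrow> s \<le> b \<Longrightarrow> norm (T s) \<le> M"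
proof -
  have "\<exists>M. \<forall>s. 0 \<le> s \<longrightarrow> s \<le> b \<longrightarrow> norm (T s) \<le> M"
  proof (rule ccontr)
    assume "\<not> ?thesis"
    then have "\<forall>n::nat. \<exists>s. 0 \<le> s \<and> s \<le> b \<and> norm (T s) > (real n + 1)\<^sup>2"
      by (meson not_le)
    then obtain s where s: "0 \<le> s n" "s n \<le> b" "norm (T (s n)) > (real n + 1)\<^sup>2" for n
      by metis
    have "\<exists>x. norm (T (s n) x) > (real n + 1)\<^sup>2 * norm x" for n
      using norm_blinfun_bound[of "(real n + 1)\<^sup>2" "T (s n)"] s(3)[of n] by (meson not_le zero_le_power2)
    then obtain x where x: "norm (T (s n) (x n)) > (real n + 1)\<^sup>2 * norm (x n)" for n
      by metis
    have nz: "x n \<noteq> 0" for n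
      using x[of n] by auto
    \<comment> \<open>Norm \<open>1 / (n + 1)\<close>, while the image under \<open>T (s n)\<close> has norm above \<open>n + 1\<close>.\<close>
    define u where "u n = (1 / ((real n + 1) * norm (x n))) *\<^sub>R x n" for n
    have "norm (u n) = 1 / (real n + 1)" for n
      using nz[of n] by (simp add: u_def)
    moreover have "(\<lambda>n. 1 / (real n + 1)) \<longlonglongrightarrow> 0"
      using LIMSEQ_inverse_real_of_nat by (simp add: inverse_eq_divide add.commute)
    ultimately have "u \<longlonglongrightarrow> 0"
      using tendsto_norm_zero_iff[of u sequentially] by simp
    then have "conv (\<lambda>n. T (s n) (u n)) 0"
      using s by (intro unif[where b=b] norm_tendsto_imp_conv) auto
    then obtain C where C: "norm (T (s n) (u n)) \<le> C" for n
      using conv_bounded by (force simp: bounded_iff)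
    have "real n + 1 < norm (T (s n) (u n))" for n
    proof -
      have "norm (T (s n) (u n)) = norm (T (s n) (x n)) / ((real n + 1) * norm (x n))"
        by (simp add: u_def blinfun.scaleR_right)
      then show ?thesis
        using x[of n] nz[of n] by (simp add: pos_less_divide_eq power2_eq_square ac_simps)
    qed
    moreover obtain n where "C < real n"
      using reals_Archimedean2 by blast
    ultimately show False
      using C[of n] by (metis add.commute less_add_one not_le order_less_trans)
  qed
  then obtain M where "\<And>s. 0 \<le> s \<Longrightarrow> s \<le> b \<Longrightarrow> norm (T s) \<le> M" by blast
  then show ?thesis
    by (intro that[of "max M 0"]) (auto simp: le_max_iff_disj)
qed

text \<open>Heine--Cantor for the pseudometric of a single seminorm on a compact interval of times.\<close>
lemma orbit_uniformly_continuous: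
  assumes p: "p \<in> P" and "0 < e"
  shows "\<exists>d>0. \<forall>s t. 0 \<le> s \<and> s \<le> b \<and> 0 \<le> t \<and> t \<le> b \<and> \<bar>s - t\<bar> \<le> d \<longrightarrow> p (T s x - T t x) < e"
proof (rule ccontr)
  assume "\<not> ?thesis"
  then have "\<forall>n::nat. \<exists>s t. 0 \<le> s \<and> s \<le> b \<and> 0 \<le> t \<and> t \<le> b \<and> \<bar>s - t\<bar> \<le> inverse (real (Suc n)) \<and>
       e \<le> p (T s x - T t x)"
    by (metis (no_types, opaque_lifting) inverse_positive_iff_positive not_le of_nat_0_less_iff zero_less_Suc)
  then obtain s t where st: "0 \<le> s n" "s n \<le> b" "0 \<le> t n" "t n \<le> b"
      "\<bar>s n - t n\<bar> \<le> inverse (real (Suc n))" "e \<le> p (T (s n) x - T (t n) x)" for n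
    by metis
  have "\<forall>n. s n \<in> {0..b}" using st by auto
  then obtain l r where l: "strict_mono r" "(s \<circ> r) \<longlonglongrightarrow> l"
    using compact_Icc[of 0 b] unfolding compact_def by (metis (no_types, lifting))
  have "(\<lambda>n. s n - t n) \<longlonglongrightarrow> 0"
    by (rule Lim_null_comparison[OF _ LIMSEQ_inverse_real_of_nat]) (use st in auto)
  then have "(\<lambda>n. s (r n) - t (r n)) \<longlonglongrightarrow> 0"
    using LIMSEQ_subseq_LIMSEQ[OF _ l(1)] by (fastforce simp: o_def)
  from tendsto_diff[OF l(2) this] have tl: "(\<lambda>n. t (r n)) \<longlonglongrightarrow> l"
    by (simp add: o_def)
  have "conv (\<lambda>n. T (s (r n)) x - T (t (r n)) x) (T l x - T l x)"
    using l(2) tl st by (intro conv_diff orbit) (auto simp: o_def)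
  then have "(\<lambda>n. p (T (s (r n)) x - T (t (r n)) x)) \<longlonglongrightarrow> 0"
    using null_seminorm p by simp
  then have "e \<le> 0"
    by (rule LIMSEQ_le_const) (use st in blast)
  with \<open>0 < e\<close> show False by simp
qed

text \<open>Recovers uniformity in time from its sequential form by picking, for each \<open>n\<close>, a time that violates
  the bound whenever there is one.\<close>
lemma unif_eventually:
  assumes "conv u 0" "p \<in> P" "0 < e"
  shows "eventually (\<lambda>n. \<forall>s. 0 \<le> s \<and> s \<le> b \<longrightarrow> p (T s (u n)) < e) sequentially"
proof (cases "0 \<le> b")
  case True
  define s where "s n = (if \<exists>s. 0 \<le> s \<and> s \<le> b \<and> e \<le> p (T s (u n))
      then SOME s. 0 \<le> s \<and> s \<le> b \<and> e \<le> p (T s (u n)) else 0)" for n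
  have s: "0 \<le> s n \<and> s n \<le> b \<and> ((\<exists>s. 0 \<le> s \<and> s \<le> b \<and> e \<le> p (T s (u n))) \<longrightarrow> e \<le> p (T (s n) (u n)))" for n
  proof (cases "\<exists>s. 0 \<le> s \<and> s \<le> b \<and> e \<le> p (T s (u n))")
    case ex: True
    from someI_ex[OF this] show ?thesis
      unfolding s_def using ex by simp
  next
    case False
    then show ?thesis unfolding s_def if_not_P[OF False] using \<open>0 \<le> b\<close> by blast
  qed
  then have "conv (\<lambda>n. T (s n) (u n)) 0"
    using assms(1) unif by blast
  then have "eventually (\<lambda>n. p (T (s n) (u n)) < e) sequentially"
    using null_seminorm assms order_tendstoD(2) by blast
  then show ?thesis
    by (rule eventually_mono) (use s not_le in blast)
qed auto

section \<open>Riemann integrals of orbits\<close>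

text \<open>The grid \<open>i / n\<close> is anchored at \<open>0\<close> and does not depend on the endpoint \<open>t\<close>. Sums for different
  endpoints are therefore directly comparable, which makes additivity of the integral elementary; the
  price is an incomplete last cell, of length at most \<open>1 / n\<close>. For \<open>n = 0\<close> the sum is \<open>0\<close>.\<close>
definition riemann_sum :: "nat \<Rightarrow> real \<Rightarrow> 'a \<Rightarrow> 'a" where
  "riemann_sum n t x = (1 / real n) *\<^sub>R (\<Sum>i<nat \<lfloor>real n * t\<rfloor>. T (real i / real n) x)"

lemma grid_point_le: "0 \<le> t \<Longrightarrow> i < nat \<lfloor>real n * t\<rfloor> \<Longrightarrow> real i / real n \<le> t"
proof -
  assume "0 \<le> t" "i < nat \<lfloor>real n * t\<rfloor>"
  then have "real i \<le> real n * t" by linarith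
  moreover have "n \<noteq> 0" using \<open>i < _\<close> by (cases n) auto
  ultimately show ?thesis by (simp add: field_simps)
qed

text \<open>The grid points below \<open>t\<close> carry the total weight \<open>floor (n t) / n\<close> instead of \<open>t\<close>, so this is the
  multiple of \<open>w\<close> with which the sum has to be compared.\<close>
lemma riemann_sum_weighted_bound:
  assumes q: "real_seminorm q" and "0 \<le> t" "0 \<le> e"
    and e: "\<And>s. 0 \<le> s \<Longrightarrow> s \<le> t \<Longrightarrow> q (T s x - w) \<le> e"
  shows "q (riemann_sum n t x - (real (nat \<lfloor>real n * t\<rfloor>) / real n) *\<^sub>R w) \<le> t * e"
proof (cases "n = 0")
  case True
  then show ?thesis using assms by (simp add: riemann_sum_def real_seminorm_zero)
next
  case False
  let ?K = "nat \<lfloor>real n * t\<rfloor>"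
  have K: "real ?K \<le> real n * t" using assms by simp
  have "riemann_sum n t x - (real ?K / real n) *\<^sub>R w = (1 / real n) *\<^sub>R (\<Sum>i<?K. T (real i / real n) x - w)"
    by (simp add: riemann_sum_def sum_subtractf scaleR_diff_right sum_constant_scaleR)
  then have "q (riemann_sum n t x - (real ?K / real n) *\<^sub>R w) =
      (1 / real n) * q (\<Sum>i<?K. T (real i / real n) x - w)"
    by (simp add: real_seminorm_scale[OF q])
  also have "q (\<Sum>i<?K. T (real i / real n) x - w) \<le> real (card {..<?K}) * e"
    by (rule real_seminorm_sum_bound[OF q]) (use e grid_point_le[OF \<open>0 \<le> t\<close>] in auto)
  also have "(1 / real n) * (real (card {..<?K}) * e) \<le> (1 / real n) * ((real n * t) * e)"
    using K \<open>0 \<le> e\<close> by (intro mult_left_mono mult_right_mono) auto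
  also have "\<dots> = t * e" using False by simp
  finally show ?thesis using False by (simp add: divide_right_mono mult_left_mono)
qed

lemma riemann_sum_bound:
  assumes "real_seminorm q" "0 \<le> t" "0 \<le> e" "\<And>s. 0 \<le> s \<Longrightarrow> s \<le> t \<Longrightarrow> q (T s x) \<le> e"
  shows "q (riemann_sum n t x) \<le> t * e"
  using riemann_sum_weighted_bound[OF assms(1-3), of x 0 n] assms(4) by simp

lemma floor_ratio_tendsto:
  assumes "0 \<le> t"
  shows "(\<lambda>n. real (nat \<lfloor>real n * t\<rfloor>) / real n) \<longlonglongrightarrow> t"
proof (rule Lim_transform2)
  show "(\<lambda>n. t) \<longlonglongrightarrow> t" by simp
  show "(\<lambda>n. t - real (nat \<lfloor>real n * t\<rfloor>) / real n) \<longlonglongrightarrow> 0"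
  proof (rule Lim_null_comparison[OF _ lim_1_over_n])
    have "norm (t - real (nat \<lfloor>real n * t\<rfloor>) / real n) \<le> 1 / real n" if "n > 0" for n
    proof -
      have "\<bar>real n * t - real (nat \<lfloor>real n * t\<rfloor>)\<bar> \<le> 1"
        using assms by (simp add: abs_le_iff) linarith
      moreover have "t - real (nat \<lfloor>real n * t\<rfloor>) / real n = (real n * t - real (nat \<lfloor>real n * t\<rfloor>)) / real n"
        using that by (simp add: field_simps)
      ultimately show ?thesis
        by (simp add: divide_right_mono)
    qed
    then show "eventually (\<lambda>n. norm (t - real (nat \<lfloor>real n * t\<rfloor>) / real n) \<le> 1 / real n) sequentially"
      by (intro eventually_mono[OF eventually_gt_at_top[of 0]])
  qed
qed

lemma sum_blocks: "(\<Sum>j<m * K. f (j div m)) = (\<Sum>i<K. real m *\<^sub>R f i)"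
  for f :: "nat \<Rightarrow> 'b::real_vector"
proof (cases "m = 0")
  case False
  have "(\<Sum>j<m * K. f (j div m)) = (\<Sum>i<K. sum (\<lambda>j. f (j div m)) {i * m..<i * m + m})"
    using sum.nat_group[of "\<lambda>j. f (j div m)" m K] by (simp add: mult.commute)
  also have "\<dots> = (\<Sum>i<K. real m *\<^sub>R f i)"
  proof (rule sum.cong[OF refl])
    fix i
    have "j div m = i" if "j \<in> {i * m..<i * m + m}" for j
      using that False by (intro div_nat_eqI) (auto simp: mult.commute)
    then have "sum (\<lambda>j. f (j div m)) {i * m..<i * m + m} = sum (\<lambda>j. f i) {i * m..<i * m + m}"
      by (intro sum.cong) auto
    then show "sum (\<lambda>j. f (j div m)) {i * m..<i * m + m} = real m *\<^sub>R f i"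
      by (simp add: sum_constant_scaleR)
  qed
  finally show ?thesis .
qed simp

text \<open>Each cell of the grid \<open>i / n\<close> consists of \<open>m\<close> cells of the finer grid, on which the orbit varies by at
  most \<open>e\<close>. Fewer than \<open>m\<close> points of the finer grid lie beyond the last full coarse cell; they
  contribute the term \<open>C / n\<close>.\<close>
lemma riemann_sum_refine:
  assumes q: "real_seminorm q" and "0 < n" "0 < m" "0 \<le> t" "0 \<le> e" "0 \<le> C"
    and e: "\<And>r s. 0 \<le> r \<Longrightarrow> r \<le> t \<Longrightarrow> 0 \<le> s \<Longrightarrow> s \<le> t \<Longrightarrow> \<bar>r - s\<bar> \<le> 1 / real n \<Longrightarrow>
        q (T r x - T s x) \<le> e"
    and C: "\<And>s. 0 \<le> s \<Longrightarrow> s \<le> t \<Longrightarrow> q (T s x) \<le> C"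
  shows "q (riemann_sum (n * m) t x - riemann_sum n t x) \<le> t * e + C / real n"
proof -
  define K where "K = nat \<lfloor>real n * t\<rfloor>"
  define L where "L = nat \<lfloor>real (n * m) * t\<rfloor>"
  have nt: "0 \<le> real n * t" "0 \<le> real (n * m) * t" using assms by auto
  have K: "real K \<le> real n * t" "real n * t < real K + 1"
    using nt(1) of_int_floor_le[of "real n * t"] floor_correct[of "real n * t"] by (simp_all add: K_def)
  have L: "real L \<le> real (n * m) * t" "real (n * m) * t < real L + 1"
    using nt(2) floor_correct[of "real (n * m) * t"] by (simp_all add: L_def del: of_nat_mult)
  have "real m * real K \<le> real m * (real n * t)" "real m * (real n * t) < real m * (real K + 1)"
    using K \<open>0 < m\<close> by auto
  then have "real (m * K) < real L + 1" "real L < real (m * K + m)"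
    using L by (auto simp: algebra_simps)
  then have KL: "m * K \<le> L" "L < m * K + m" by linarith+
  let ?g = "\<lambda>j. T (real j / real (n * m)) x" and ?h = "\<lambda>j. T (real (j div m) / real n) x"
  let ?D = "(\<Sum>j<m * K. ?g j - ?h j) + (\<Sum>j=m*K..<L. ?g j)"
  have "riemann_sum n t x = (1 / real (n * m)) *\<^sub>R (\<Sum>j<m * K. ?h j)"
    unfolding sum_blocks[of "\<lambda>i. T (real i / real n) x" m K] riemann_sum_def
    using \<open>0 < m\<close> by (simp add: K_def flip: scaleR_sum_right)
  moreover have "(\<Sum>j<L. ?g j) = (\<Sum>j<m * K. ?g j) + (\<Sum>j=m*K..<L. ?g j)"
    using KL(1) sum.atLeastLessThan_concat[of 0 "m * K" L ?g] by (simp add: atLeast0LessThan)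
  ultimately have eq: "riemann_sum (n * m) t x - riemann_sum n t x = (1 / real (n * m)) *\<^sub>R ?D"
    unfolding riemann_sum_def[of "n * m"] by (simp add: L_def sum_subtractf algebra_simps)
  have le1: "real j / real (n * m) \<le> t" if "j < L" for j
    using grid_point_le[OF \<open>0 \<le> t\<close>] that unfolding L_def by blast
  have "q (?g j - ?h j) \<le> e" if "j < m * K" for j
  proof (rule e)
    show "real j / real (n * m) \<le> t" using le1 that KL by simp
    have "j div m < K" using that by (simp add: less_mult_imp_div_less mult.commute)
    then show "real (j div m) / real n \<le> t"
      using grid_point_le[OF \<open>0 \<le> t\<close>] unfolding K_def by blast
    have "real j = real m * real (j div m) + real (j mod m)"
      by (metis mult_div_mod_eq of_nat_add of_nat_mult)
    then have "real j / real (n * m) - real (j div m) / real n = real (j mod m) / real (n * m)"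
      using assms(2,3) by (simp add: field_simps)
    moreover have "real (j mod m) / real (n * m) \<le> real m / real (n * m)"
      using \<open>0 < m\<close> by (intro divide_right_mono) (auto simp: less_imp_le)
    ultimately show "\<bar>real j / real (n * m) - real (j div m) / real n\<bar> \<le> 1 / real n"
      using assms(2,3) by simp
  qed auto
  then have "q (\<Sum>j<m * K. ?g j - ?h j) \<le> real (card {..<m * K}) * e"
    by (intro real_seminorm_sum_bound[OF q]) auto
  moreover have "real (card {..<m * K}) * e \<le> (real (n * m) * t) * e"
    using K \<open>0 < m\<close> \<open>0 \<le> e\<close> by (intro mult_right_mono) (auto simp: algebra_simps mult_left_mono)
  moreover have "q (\<Sum>j=m*K..<L. ?g j) \<le> real (card {m*K..<L}) * C"
    using C le1 by (intro real_seminorm_sum_bound[OF q]) auto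
  moreover have "real (card {m*K..<L}) * C \<le> real m * C"
  proof (intro mult_right_mono \<open>0 \<le> C\<close>)
    have "card {m*K..<L} \<le> m" using KL by simp
    then show "real (card {m*K..<L}) \<le> real m" by (simp only: of_nat_le_iff)
  qed
  ultimately have "q ?D \<le> real (n * m) * t * e + real m * C"
    using real_seminorm_add[OF q, of "\<Sum>j<m * K. ?g j - ?h j" "\<Sum>j=m*K..<L. ?g j"] by linarith
  then have "q (riemann_sum (n * m) t x - riemann_sum n t x) \<le> (1 / real (n * m)) * (real (n * m) * t * e + real m * C)"
    unfolding eq real_seminorm_scale[OF q] by (simp add: divide_right_mono)
  also have "\<dots> = t * e + C / real n" using assms(2,3) by (simp add: field_simps)
  finally show ?thesis .
qed

end

section \<open>Generators and their relation to integrals\<close>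

context norming_seminorms
begin

text \<open>The graph of the generator of \<open>S\<close>, taken as a relation because the domain is in general a proper
  subspace.\<close>
definition gen :: "(real \<Rightarrow> ('a \<Rightarrow>\<^sub>L 'a)) \<Rightarrow> 'a \<Rightarrow> 'a \<Rightarrow> bool" where
  "gen S x y \<longleftrightarrow>
     (\<forall>r. (\<forall>n. 0 < r n) \<longrightarrow> r \<longlonglongrightarrow> 0 \<longrightarrow> conv (\<lambda>n. (1 / r n) *\<^sub>R (S (r n) x - x)) y)"

lemma genI:
  "(\<And>r. (\<And>n. 0 < r n) \<Longrightarrow> r \<longlonglongrightarrow> 0 \<Longrightarrow> conv (\<lambda>n. (1 / r n) *\<^sub>R (S (r n) x - x)) y) \<Longrightarrow> gen S x y"
  for S :: "real \<Rightarrow> ('a \<Rightarrow>\<^sub>L 'a)"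
  by (simp add: gen_def)

lemma genD: "gen S x y \<Longrightarrow> (\<And>n. 0 < r n) \<Longrightarrow> r \<longlonglongrightarrow> 0 \<Longrightarrow>
    conv (\<lambda>n. (1 / r n) *\<^sub>R (S (r n) x - x)) y"
  for S :: "real \<Rightarrow> ('a \<Rightarrow>\<^sub>L 'a)"
  by (simp add: gen_def)

lemma gen_unique:
  assumes "gen S x y" "gen S x z"
  shows "y = z"
proof (rule conv_unique)
  let ?r = "\<lambda>n. inverse (real (Suc n))"
  show "conv (\<lambda>n. (1 / ?r n) *\<^sub>R (S (?r n) x - x)) y" "conv (\<lambda>n. (1 / ?r n) *\<^sub>R (S (?r n) x - x)) z"
    by (intro genD assms LIMSEQ_inverse_real_of_nat; simp)+
qed

lemma gen_conv_cont:
  fixes S :: "real \<Rightarrow> ('a \<Rightarrow>\<^sub>L 'a)"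
  assumes "gen S x y" "conv_cont L" and comm: "\<And>s x. 0 \<le> s \<Longrightarrow> L (S s x) = S s (L x)"
  shows "gen S (L x) (L y)"
proof (rule genI)
  fix r :: "nat \<Rightarrow> real" assume r: "\<And>n. 0 < r n" "r \<longlonglongrightarrow> 0"
  have "L ((1 / r n) *\<^sub>R (S (r n) x - x)) = (1 / r n) *\<^sub>R (S (r n) (L x) - L x)" for n
    using comm[of "r n" x] r(1)[of n]
    by (simp add: linear_cmul[OF conv_cont_linear[OF assms(2)]] linear_diff[OF conv_cont_linear[OF assms(2)]])
  with conv_cont_conv[OF assms(2) genD[OF assms(1) r]]
  show "conv (\<lambda>n. (1 / r n) *\<^sub>R (S (r n) (L x) - L x)) (L y)" by simp
qed

lemma exp_difference_quotient:
  assumes "\<And>n. 0 < r n" "r \<longlonglongrightarrow> 0"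
  shows "(\<lambda>n. (exp (c * r n) - 1) / r n) \<longlonglongrightarrow> (c :: real)"
proof -
  have "((\<lambda>t. exp (c * t)) has_real_derivative c) (at 0)"
    by (auto intro!: derivative_eq_intros)
  then have "((\<lambda>h. (exp (c * h) - 1) / h) \<longlongrightarrow> c) (at 0)"
    by (simp add: DERIV_def)
  moreover have "filterlim r (at 0) sequentially"
    using assms by (auto simp: filterlim_at less_imp_neq[THEN not_sym])
  ultimately show ?thesis by (rule filterlim_compose)
qed

lemma gen_rescale:
  fixes S :: "real \<Rightarrow> ('a \<Rightarrow>\<^sub>L 'a)"
  assumes "gen S x y"
  shows "gen (\<lambda>s. exp (c * s) *\<^sub>R S s) x (y + c *\<^sub>R x)"
proof (rule genI)
  fix r :: "nat \<Rightarrow> real" assume r: "\<And>n. 0 < r n" "r \<longlonglongrightarrow> 0"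
  have "(\<lambda>n. exp (c * r n)) \<longlonglongrightarrow> exp (c * 0)"
    by (intro tendsto_intros r)
  then have "conv (\<lambda>n. exp (c * r n) *\<^sub>R ((1 / r n) *\<^sub>R (S (r n) x - x)) + ((exp (c * r n) - 1) / r n) *\<^sub>R x)
      (1 *\<^sub>R y + c *\<^sub>R x)"
    by (intro conv_add conv_scaleR_var genD[OF assms r] conv_const exp_difference_quotient r) simp
  then show "conv (\<lambda>n. (1 / r n) *\<^sub>R ((exp (c * r n) *\<^sub>R S (r n)) x - x)) (y + c *\<^sub>R x)"
    by (simp add: scaleR_blinfun.rep_eq algebra_simps diff_divide_distrib)
qed

end

context seminorm_bicontinuous_semigroup
begin

lemma seminorm_T_le: "p \<in> P \<Longrightarrow> norm (T s) \<le> M \<Longrightarrow> p (T s x) \<le> M * norm x"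
  by (meson le_norm mult_right_mono norm_blinfun norm_ge_zero order_trans)

text \<open>Sums for \<open>n\<close> and \<open>m\<close> are compared through their common refinement \<open>n * m\<close>.\<close>
lemma ex_riemann_sum_limit:
  assumes "0 \<le> t"
  shows "\<exists>l. conv (\<lambda>n. riemann_sum n t x) l"
proof -
  obtain M where M: "0 \<le> M" "\<And>s. 0 \<le> s \<Longrightarrow> s \<le> t \<Longrightarrow> norm (T s) \<le> M"
    using T_bounded by blast
  define C where "C = M * norm x"
  have C: "0 \<le> C" "\<And>s. 0 \<le> s \<Longrightarrow> s \<le> t \<Longrightarrow> norm (T s x) \<le> C"
    using M by (auto simp: C_def intro!: order_trans[OF norm_blinfun] mult_right_mono)
  have "real_seminorm norm" by (simp add: real_seminorm_def norm_triangle_ineq)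
  then have "norm (riemann_sum n t x) \<le> t * C" for n
    using riemann_sum_bound[of norm t C x n] assms C by blast
  then have bdd: "bounded (range (\<lambda>n. riemann_sum n t x))"
    by (auto simp: bounded_iff)
  have "\<exists>N. \<forall>m\<ge>N. \<forall>n\<ge>N. p (riemann_sum m t x - riemann_sum n t x) < e" if p: "p \<in> P" and "0 < e" for p e
  proof -
    note s = seminorm[OF p]
    define e' where "e' = e / (4 * (t + 1))"
    have e': "0 < e'" "t * e' < e / 4"
      using assms \<open>0 < e\<close> by (auto simp: e'_def field_simps)
    obtain d where d: "0 < d" "\<And>r s. 0 \<le> r \<Longrightarrow> r \<le> t \<Longrightarrow> 0 \<le> s \<Longrightarrow> s \<le> t \<Longrightarrow> \<bar>r - s\<bar> \<le> d \<Longrightarrow>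
        p (T r x - T s x) < e'"
      using orbit_uniformly_continuous[OF p e'(1), of t x] by blast
    obtain N where N: "real N > max (max 1 (1 / d)) (4 * C / e)"
      using reals_Archimedean2 by blast
    have step: "p (riemann_sum (n * m) t x - riemann_sum n t x) < e / 2" if "N \<le> n" "N \<le> m" for n m
    proof -
      have n: "real n \<ge> real N" "real m \<ge> real N" using that by auto
      have "1 < d * real n" "4 * C < real n * e"
        using n N d(1) \<open>0 < e\<close> by (auto simp: field_simps intro: less_le_trans mult_left_mono)
      moreover have "0 < n" "0 < m" using n N by auto
      ultimately have "1 / real n \<le> d" "C / real n < e / 4"
        by (auto simp: field_simps)
      have "p (riemann_sum (n * m) t x - riemann_sum n t x) \<le> t * e' + C / real n"
      proof (rule riemann_sum_refine[OF s \<open>0 < n\<close> \<open>0 < m\<close> assms])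
        show "p (T r x - T s x) \<le> e'"
          if "0 \<le> r" "r \<le> t" "0 \<le> s" "s \<le> t" "\<bar>r - s\<bar> \<le> 1 / real n" for r s
          using d(2)[of r s] that \<open>1 / real n \<le> d\<close> by simp
        show "p (T s x) \<le> C" if "0 \<le> s" "s \<le> t" for s
          using C(2)[OF that] le_norm[OF p] order_trans by blast
      qed (use e' C in auto)
      with \<open>C / real n < e / 4\<close> e' show ?thesis by linarith
    qed
    have "p (riemann_sum m t x - riemann_sum n t x) < e" if "N \<le> m" "N \<le> n" for m n
      using step[of m n] step[of n m] that
        real_seminorm_triangle[OF s, of "riemann_sum m t x" "riemann_sum n t x" "riemann_sum (m * n) t x"]
        real_seminorm_swap[OF s, of "riemann_sum m t x" "riemann_sum (m * n) t x"]
      by (simp add: mult.commute)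
    then show ?thesis by blast
  qed
  with bdd show ?thesis
    using completeE[of "\<lambda>n. riemann_sum n t x"] by blast
qed

definition orbit_integral :: "real \<Rightarrow> 'a \<Rightarrow> 'a" where
  "orbit_integral t x = (SOME l. conv (\<lambda>n. riemann_sum n t x) l)"

lemma conv_orbit_integral: "0 \<le> t \<Longrightarrow> conv (\<lambda>n. riemann_sum n t x) (orbit_integral t x)"
  unfolding orbit_integral_def by (rule someI_ex[OF ex_riemann_sum_limit])

lemma orbit_integral_eqI: "0 \<le> t \<Longrightarrow> conv (\<lambda>n. riemann_sum n t x) l \<Longrightarrow> orbit_integral t x = l"
  using conv_orbit_integral conv_unique by blast

text \<open>Stated for every seminorm that is continuous for \<^const>\<open>conv\<close>, since it is needed both for the
  members of \<open>P\<close> and for the absolute value of a functional.\<close>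
lemma orbit_integral_estimate:
  assumes q: "real_seminorm q" "\<And>u l. conv u l \<Longrightarrow> (\<lambda>n. q (u n - l)) \<longlonglongrightarrow> 0"
    and "0 \<le> t" "0 \<le> e" "\<And>s. 0 \<le> s \<Longrightarrow> s \<le> t \<Longrightarrow> q (T s x - w) \<le> e"
  shows "q (orbit_integral t x - t *\<^sub>R w) \<le> t * e"
proof (rule seminorm_lsc[OF q(1) _ tendsto_const])
  show "q (riemann_sum n t x - (real (nat \<lfloor>real n * t\<rfloor>) / real n) *\<^sub>R w) \<le> t * e" for n
    by (rule riemann_sum_weighted_bound) (use assms in auto)
  show "(\<lambda>n. q (riemann_sum n t x - (real (nat \<lfloor>real n * t\<rfloor>) / real n) *\<^sub>R w - (orbit_integral t x - t *\<^sub>R w))) \<longlonglongrightarrow> 0"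
    by (intro q(2) conv_diff conv_orbit_integral conv_scaleR_var conv_const floor_ratio_tendsto assms)
qed

lemma orbit_integral_mean_estimate:
  assumes "real_seminorm q" "\<And>u l. conv u l \<Longrightarrow> (\<lambda>n. q (u n - l)) \<longlonglongrightarrow> 0"
    and "0 < t" "0 \<le> e" "\<And>s. 0 \<le> s \<Longrightarrow> s \<le> t \<Longrightarrow> q (T s x - w) \<le> e"
  shows "q ((1 / t) *\<^sub>R orbit_integral t x - w) \<le> e"
proof -
  have "(1 / t) *\<^sub>R orbit_integral t x - w = (1 / t) *\<^sub>R (orbit_integral t x - t *\<^sub>R w)"
    using \<open>0 < t\<close> by (simp add: scaleR_diff_right)
  then have "q ((1 / t) *\<^sub>R orbit_integral t x - w) = (1 / t) * q (orbit_integral t x - t *\<^sub>R w)"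
    using \<open>0 < t\<close> by (simp add: real_seminorm_scale[OF assms(1)])
  also have "\<dots> \<le> (1 / t) * (t * e)"
    using assms by (intro mult_left_mono orbit_integral_estimate) auto
  finally show ?thesis using \<open>0 < t\<close> by simp
qed

lemma norm_orbit_integral_le:
  assumes "0 \<le> t" "0 \<le> M" "\<And>s. 0 \<le> s \<Longrightarrow> s \<le> t \<Longrightarrow> norm (T s) \<le> M"
  shows "norm (orbit_integral t x) \<le> t * (M * norm x)"
proof (rule norm_leI)
  fix p assume p: "p \<in> P"
  have "p (orbit_integral t x - t *\<^sub>R 0) \<le> t * (M * norm x)"
    by (rule orbit_integral_estimate[OF seminorm[OF p] conv_seminorm[OF _ p]])
      (use assms seminorm_T_le[OF p] in auto)
  then show "p (orbit_integral t x) \<le> t * (M * norm x)" by simp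
qed

lemma riemann_sum_commute:
  assumes "linear L" "\<And>s x. 0 \<le> s \<Longrightarrow> L (T s x) = T s (L x)"
  shows "L (riemann_sum n t x) = riemann_sum n t (L x)"
  using assms by (simp add: riemann_sum_def linear_cmul linear_sum)

lemma orbit_integral_commute:
  assumes "0 \<le> t" "conv_cont L" "\<And>s x. 0 \<le> s \<Longrightarrow> L (T s x) = T s (L x)"
  shows "L (orbit_integral t x) = orbit_integral t (L x)"
proof (rule sym, rule orbit_integral_eqI[OF assms(1)])
  show "conv (\<lambda>n. riemann_sum n t (L x)) (L (orbit_integral t x))"
    using conv_cont_conv[OF assms(2) conv_orbit_integral[OF assms(1), of x]]
    by (simp add: riemann_sum_commute[OF conv_cont_linear[OF assms(2)] assms(3)])
qed

lemma linear_orbit_integral: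
  assumes "0 \<le> t"
  shows "linear (orbit_integral t)"
proof (rule linearI)
  fix x y c
  have "riemann_sum n t (x + y) = riemann_sum n t x + riemann_sum n t y" "riemann_sum n t (c *\<^sub>R x) = c *\<^sub>R riemann_sum n t x" for n
    by (simp_all add: riemann_sum_def blinfun.add_right blinfun.scaleR_right sum.distrib scaleR_add_right
        flip: scaleR_sum_right)
  then show "orbit_integral t (x + y) = orbit_integral t x + orbit_integral t y" "orbit_integral t (c *\<^sub>R x) = c *\<^sub>R orbit_integral t x"
    using conv_add[OF conv_orbit_integral[OF assms, of x] conv_orbit_integral[OF assms, of y]]
      conv_scaleR[OF conv_orbit_integral[OF assms, of x], of c]
    by (simp_all add: orbit_integral_eqI[OF assms])
qed

text \<open>The lengths \<open>r n\<close> of the intervals may vary with \<open>n\<close>, since the bound on the orbits is uniform in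
  time.\<close>
lemma mean_null:
  assumes "conv u 0" "\<And>n. 0 < r n" "\<And>n. r n \<le> b"
  shows "conv (\<lambda>n. (1 / r n) *\<^sub>R orbit_integral (r n) (u n)) 0"
  unfolding conv_def
proof (intro conjI ballI)
  obtain M where M: "0 \<le> M" "\<And>s. 0 \<le> s \<Longrightarrow> s \<le> b \<Longrightarrow> norm (T s) \<le> M"
    using T_bounded by blast
  obtain U where U: "norm (u n) \<le> U" for n
    using conv_bounded[OF assms(1)] by (auto simp: bounded_iff)
  have "norm ((1 / r n) *\<^sub>R orbit_integral (r n) (u n)) \<le> M * U" for n
  proof -
    have "norm (orbit_integral (r n) (u n)) \<le> r n * (M * norm (u n))"
      using assms(2,3)[of n] M by (intro norm_orbit_integral_le) auto
    also have "\<dots> \<le> r n * (M * U)"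
      using assms(2)[of n] M(1) U[of n] by (intro mult_left_mono) auto
    finally show ?thesis using assms(2)[of n] by (simp add: field_simps)
  qed
  then show "bounded (range (\<lambda>n. (1 / r n) *\<^sub>R orbit_integral (r n) (u n)))"
    by (auto simp: bounded_iff)
  fix p assume p: "p \<in> P"
  show "(\<lambda>n. p ((1 / r n) *\<^sub>R orbit_integral (r n) (u n) - 0)) \<longlonglongrightarrow> 0"
  proof (rule tendstoI)
    fix e :: real assume "0 < e"
    then have "eventually (\<lambda>n. \<forall>s. 0 \<le> s \<and> s \<le> b \<longrightarrow> p (T s (u n)) < e / 2) sequentially"
      by (intro unif_eventually assms p) auto
    then show "eventually (\<lambda>n. dist (p ((1 / r n) *\<^sub>R orbit_integral (r n) (u n) - 0)) 0 < e) sequentially"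
    proof (rule eventually_mono)
      fix n assume n: "\<forall>s. 0 \<le> s \<and> s \<le> b \<longrightarrow> p (T s (u n)) < e / 2"
      have "p ((1 / r n) *\<^sub>R orbit_integral (r n) (u n) - 0) \<le> e / 2"
      proof (rule orbit_integral_mean_estimate[OF seminorm[OF p] conv_seminorm[OF _ p]])
        show "p (T s (u n) - 0) \<le> e / 2" if "0 \<le> s" "s \<le> r n" for s
          using n that assms(3)[of n] by (simp add: less_imp_le)
      qed (use assms \<open>0 < e\<close> in auto)
      then show "dist (p ((1 / r n) *\<^sub>R orbit_integral (r n) (u n) - 0)) 0 < e"
        using real_seminorm_nonneg[OF seminorm[OF p], of "(1 / r n) *\<^sub>R orbit_integral (r n) (u n)"] \<open>0 < e\<close>
        by (simp add: dist_real_def)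
    qed
  qed
qed

lemma conv_cont_orbit_integral:
  assumes "0 < t"
  shows "conv_cont (orbit_integral t)"
proof (rule conv_contI_null)
  fix u assume "conv u 0"
  then have "conv (\<lambda>n. (1 / t) *\<^sub>R orbit_integral t (u n)) 0"
    using assms by (intro mean_null[where b = t]) auto
  from conv_scaleR[OF this, of t] show "conv (\<lambda>n. orbit_integral t (u n)) 0"
    using assms by simp
qed (use assms linear_orbit_integral in simp)

lemma orbit_integral_zero: "orbit_integral 0 x = 0"
  using orbit_integral_eqI[of 0 x 0] conv_const[of 0] by (simp add: riemann_sum_def)

lemma conv_mean:
  assumes "conv u x" "\<And>n. 0 < r n" "r \<longlonglongrightarrow> 0"
  shows "conv (\<lambda>n. (1 / r n) *\<^sub>R orbit_integral (r n) (u n)) x"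
proof -
  obtain b where "norm (r n) \<le> b" for n
    using convergent_imp_bounded[OF assms(3)] by (auto simp: bounded_iff)
  then have b: "r n \<le> b" for n
    by (simp add: abs_le_iff)
  have "conv (\<lambda>n. (1 / r n) *\<^sub>R orbit_integral (r n) x - x) 0"
    unfolding conv_def
  proof (intro conjI ballI)
    obtain M where M: "0 \<le> M" "\<And>s. 0 \<le> s \<Longrightarrow> s \<le> b \<Longrightarrow> norm (T s) \<le> M"
      using T_bounded by blast
    have "norm ((1 / r n) *\<^sub>R orbit_integral (r n) x - x) \<le> M * norm x + norm x" for n
    proof -
      have "norm (orbit_integral (r n) x) \<le> r n * (M * norm x)"
        using assms(2)[of n] b[of n] M by (intro norm_orbit_integral_le) auto
      then have "norm ((1 / r n) *\<^sub>R orbit_integral (r n) x) \<le> M * norm x"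
        using assms(2)[of n] by (simp add: field_simps)
      then show ?thesis
        using norm_triangle_ineq4[of "(1 / r n) *\<^sub>R orbit_integral (r n) x" x] by linarith
    qed
    then show "bounded (range (\<lambda>n. (1 / r n) *\<^sub>R orbit_integral (r n) x - x))"
      unfolding bounded_iff by blast
    fix p assume p: "p \<in> P"
    show "(\<lambda>n. p ((1 / r n) *\<^sub>R orbit_integral (r n) x - x - 0)) \<longlonglongrightarrow> 0"
    proof (rule tendstoI)
      fix e :: real assume "0 < e"
      then obtain d where d: "0 < d" "\<And>s. 0 \<le> s \<Longrightarrow> s \<le> b \<Longrightarrow> s \<le> d \<Longrightarrow> p (T s x - x) < e / 2"
        using orbit_uniformly_continuous[OF p, of "e / 2" b x]
        by (metis (no_types, opaque_lifting) T_zero abs_of_nonneg diff_zero half_gt_zero order.refl order.trans)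
      have "eventually (\<lambda>n. r n < d) sequentially"
        using order_tendstoD(2)[OF assms(3) d(1)] .
      then show "eventually (\<lambda>n. dist (p ((1 / r n) *\<^sub>R orbit_integral (r n) x - x - 0)) 0 < e) sequentially"
      proof (rule eventually_mono)
        fix n assume n: "r n < d"
        have "p ((1 / r n) *\<^sub>R orbit_integral (r n) x - x) \<le> e / 2"
        proof (rule orbit_integral_mean_estimate[OF seminorm[OF p] conv_seminorm[OF _ p]])
          show "p (T s x - x) \<le> e / 2" if "0 \<le> s" "s \<le> r n" for s
            using d(2)[of s] n that b[of n] by simp
        qed (use assms \<open>0 < e\<close> in auto)
        then show "dist (p ((1 / r n) *\<^sub>R orbit_integral (r n) x - x - 0)) 0 < e"
          using real_seminorm_nonneg[OF seminorm[OF p], of "(1 / r n) *\<^sub>R orbit_integral (r n) x - x"] \<open>0 < e\<close>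
          by (simp add: dist_real_def)
      qed
    qed
  qed
  moreover have "conv (\<lambda>n. (1 / r n) *\<^sub>R orbit_integral (r n) (u n - x)) 0"
    using assms b by (intro mean_null[where b = b]) (auto simp: conv_null_iff)
  ultimately have "conv (\<lambda>n. ((1 / r n) *\<^sub>R orbit_integral (r n) x - x) + (1 / r n) *\<^sub>R orbit_integral (r n) (u n - x) + x) (0 + 0 + x)"
    by (intro conv_add conv_const)
  moreover have "orbit_integral (r n) (u n - x) = orbit_integral (r n) (u n) - orbit_integral (r n) x" for n
    using assms(2)[of n] by (simp add: linear_diff linear_orbit_integral)
  ultimately show ?thesis
    by (simp add: scaleR_diff_right)
qed

text \<open>Replacing \<open>r\<close> by the grid point \<open>g n\<close> below it makes translation an exact shift of the grid. The
  resulting sum then differs from the difference of the sums up to \<open>t + r\<close> and \<open>r\<close> by at most one grid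
  point.\<close>
lemma orbit_integral_translate:
  assumes "0 \<le> r" "0 \<le> t"
  shows "T r (orbit_integral t x) = orbit_integral (t + r) x - orbit_integral r x"
proof -
  obtain M where M: "0 \<le> M" "\<And>s. 0 \<le> s \<Longrightarrow> s \<le> t + r \<Longrightarrow> norm (T s) \<le> M"
    using T_bounded by blast
  define g where "g n = real (nat \<lfloor>real n * r\<rfloor>) / real n" for n
  define D where "D n = riemann_sum n (t + r) x - riemann_sum n r x - T (g n) (riemann_sum n t x)" for n
  have "norm (D n) \<le> (M * norm x) * (1 / real n)" for n
  proof (cases "n = 0")
    case True
    then show ?thesis by (simp add: D_def riemann_sum_def)
  next
    case False
    define K where "K = nat \<lfloor>real n * t\<rfloor>"
    define R where "R = nat \<lfloor>real n * r\<rfloor>"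
    define L where "L = nat \<lfloor>real n * (t + r)\<rfloor>"
    have "real n * (t + r) = real n * t + real n * r" by (simp add: algebra_simps)
    moreover have "0 \<le> real n * t" "0 \<le> real n * r" using assms by auto
    ultimately have KRL: "R + K \<le> L" "L \<le> Suc (R + K)"
      unfolding K_def R_def L_def by linarith+
    let ?f = "\<lambda>i. T (real i / real n) x"
    have "T (g n) (riemann_sum n t x) = (1 / real n) *\<^sub>R (\<Sum>i<K. T (g n) (?f i))"
      by (simp add: riemann_sum_def K_def blinfun.scaleR_right blinfun.sum_right)
    also have "(\<Sum>i<K. T (g n) (?f i)) = (\<Sum>i<K. ?f (R + i))"
      by (intro sum.cong refl) (simp add: g_def R_def add_divide_distrib flip: T_add)
    also have "\<dots> = (\<Sum>i=R..<R + K. ?f i)"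
      using sum.shift_bounds_nat_ivl[of ?f 0 R K] by (simp add: atLeast0LessThan add.commute)
    finally have "T (g n) (riemann_sum n t x) = (1 / real n) *\<^sub>R (\<Sum>i=R..<R + K. ?f i)" .
    moreover have "(\<Sum>i<L. ?f i) = (\<Sum>i<R. ?f i) + (\<Sum>i=R..<R + K. ?f i) + (\<Sum>i=R + K..<L. ?f i)"
      using KRL sum.atLeastLessThan_concat[of 0 "R + K" L ?f] sum.atLeastLessThan_concat[of 0 R "R + K" ?f]
      by (simp add: atLeast0LessThan)
    ultimately have "D n = (1 / real n) *\<^sub>R (\<Sum>i=R + K..<L. ?f i)"
      unfolding D_def riemann_sum_def L_def[symmetric] R_def[symmetric] K_def[symmetric]
      by (simp add: algebra_simps)
    then have "norm (D n) = (1 / real n) * norm (\<Sum>i=R + K..<L. ?f i)" by simp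
    also have "norm (\<Sum>i=R + K..<L. ?f i) \<le> real (card {R + K..<L}) * (M * norm x)"
    proof (rule sum_norm_bound)
      fix i assume "i \<in> {R + K..<L}"
      then have "real i / real n \<le> t + r"
        using grid_point_le[of "t + r" i n] assms by (simp add: L_def)
      then show "norm (?f i) \<le> M * norm x"
        using M by (intro order_trans[OF norm_blinfun] mult_right_mono) auto
    qed
    also have "\<dots> \<le> 1 * (M * norm x)"
    proof (intro mult_right_mono)
      have "card {R + K..<L} \<le> 1" using KRL by simp
      then show "real (card {R + K..<L}) \<le> 1" by linarith
    qed (use M in simp)
    finally show ?thesis
      by (simp add: divide_right_mono mult.commute)
  qed
  then have "D \<longlonglongrightarrow> 0"
    by (intro Lim_null_comparison[of D "\<lambda>n. (M * norm x) * (1 / real n)"] tendsto_mult_right_zero lim_1_over_n) auto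
  then have "conv D 0" by (rule norm_tendsto_imp_conv)
  moreover have "conv D (orbit_integral (t + r) x - orbit_integral r x - T r (orbit_integral t x))"
    unfolding D_def using assms floor_ratio_tendsto[OF assms(1)]
    by (intro conv_diff conv_orbit_integral conv_T) (auto simp: g_def)
  ultimately show ?thesis
    using conv_unique by fastforce
qed

text \<open>Exchanging the roles of the two times in \<open>orbit_integral_translate\<close> shows that the difference quotient
  of \<open>T\<close> at the integral over \<open>[0, t]\<close> is \<open>T t - 1\<close> applied to the mean over \<open>[0, r n]\<close>, and these means
  tend to \<open>x\<close>.\<close>
lemma gen_orbit_integral:
  assumes "0 \<le> t"
  shows "gen T (orbit_integral t x) (T t x - x)"
proof (rule genI)
  fix r :: "nat \<Rightarrow> real" assume r: "\<And>n. 0 < r n" "r \<longlonglongrightarrow> 0"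
  let ?J = "\<lambda>n. (1 / r n) *\<^sub>R orbit_integral (r n) x"
  have "conv (\<lambda>n. T t (?J n) - ?J n) (T t x - x)"
    using assms by (intro conv_diff conv_cont_conv[OF conv_cont_T] conv_mean conv_const r)
  moreover have "(1 / r n) *\<^sub>R (T (r n) (orbit_integral t x) - orbit_integral t x) = T t (?J n) - ?J n" for n
    using orbit_integral_translate[of "r n" t x] orbit_integral_translate[of t "r n" x] r(1)[of n] assms
    by (simp add: blinfun.scaleR_right add.commute flip: scaleR_diff_right)
  ultimately show "conv (\<lambda>n. (1 / r n) *\<^sub>R (T (r n) (orbit_integral t x) - orbit_integral t x)) (T t x - x)"
    by simp
qed

lemma orbit_integral_T: "0 \<le> t \<Longrightarrow> 0 \<le> s \<Longrightarrow> T s (orbit_integral t x) = orbit_integral t (T s x)"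
  by (rule orbit_integral_commute) (auto intro: conv_cont_T T_commute)

text \<open>The integral commutes with the semigroup, hence with its generator, so the left-hand side is the
  generator applied to the integral of the orbit of \<open>x\<close>.\<close>
lemma gen_imp_orbit_integral:
  assumes "0 \<le> t" "gen T x y"
  shows "orbit_integral t y = T t x - x"
proof (cases "t = 0")
  case True
  then show ?thesis by (simp add: orbit_integral_zero T_zero)
next
  case False
  with assms have "gen T (orbit_integral t x) (orbit_integral t y)"
    by (intro gen_conv_cont[where L = "orbit_integral t"] conv_cont_orbit_integral) (auto simp: orbit_integral_T)
  then show ?thesis
    using gen_orbit_integral[OF assms(1)] gen_unique by blast
qed

lemma gen_imp_norm_le:
  assumes "gen T x y" "0 \<le> t" "0 \<le> M" "\<And>s. 0 \<le> s \<Longrightarrow> s \<le> t \<Longrightarrow> norm (T s) \<le> M"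
  shows "norm (T t x - x) \<le> t * (M * norm y)"
  using norm_orbit_integral_le[OF assms(2-4), of y] gen_imp_orbit_integral[OF assms(2,1)] by simp

text \<open>Rescaling reduces resolvents to finite integrals: integrals of the rescaled orbits are the Laplace
  transform truncated to a bounded interval.\<close>
lemma rescaled: "seminorm_bicontinuous_semigroup P (\<lambda>s. exp (c * s) *\<^sub>R T s)"
proof
  show "(exp (c * 0) *\<^sub>R T 0) x = x" for x
    by (simp add: T_zero scaleR_blinfun.rep_eq)
  show "(exp (c * (s + t)) *\<^sub>R T (s + t)) x = (exp (c * s) *\<^sub>R T s) ((exp (c * t) *\<^sub>R T t) x)"
    if "0 \<le> s" "0 \<le> t" for s t x
    using that by (simp add: T_add scaleR_blinfun.rep_eq blinfun.scaleR_right exp_add distrib_left)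
  show "conv (\<lambda>n. (exp (c * r n) *\<^sub>R T (r n)) x) ((exp (c * t) *\<^sub>R T t) x)"
    if "\<And>n. 0 \<le> r n" "r \<longlonglongrightarrow> t" for r t x
    unfolding scaleR_blinfun.rep_eq
    by (intro conv_scaleR_var orbit that tendsto_intros)
  show "conv (\<lambda>n. (exp (c * r n) *\<^sub>R T (r n)) (u n)) 0"
    if "conv u 0" "\<And>n. 0 \<le> r n \<and> r n \<le> b" for r u b
  proof -
    have bd: "exp (c * r n) \<le> exp (\<bar>c\<bar> * b)" for n
    proof -
      have "c * r n \<le> \<bar>c\<bar> * r n" using that(2)[of n] by (intro mult_right_mono) auto
      also have "\<dots> \<le> \<bar>c\<bar> * b" using that(2)[of n] by (intro mult_left_mono) auto
      finally show ?thesis by simp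
    qed
    have cT: "conv (\<lambda>n. T (r n) (u n)) 0" using that unif by blast
    obtain C where C: "norm (T (r n) (u n)) \<le> C" for n
      using conv_bounded[OF cT] by (auto simp: bounded_iff)
    show ?thesis
      unfolding conv_def scaleR_blinfun.rep_eq
    proof (intro conjI ballI)
      have "norm (exp (c * r n) *\<^sub>R T (r n) (u n)) \<le> exp (\<bar>c\<bar> * b) * C" for n
        using bd[of n] C[of n] by (simp add: mult_mono)
      then show "bounded (range (\<lambda>n. exp (c * r n) *\<^sub>R T (r n) (u n)))"
        unfolding bounded_iff by blast
      fix p assume p: "p \<in> P"
      have "(\<lambda>n. exp (\<bar>c\<bar> * b) * p (T (r n) (u n))) \<longlonglongrightarrow> 0"
        by (intro tendsto_mult_right_zero null_seminorm[OF cT p])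
      then show "(\<lambda>n. p (exp (c * r n) *\<^sub>R T (r n) (u n) - 0)) \<longlonglongrightarrow> 0"
        using bd real_seminorm_nonneg[OF seminorm[OF p]]
        by - (rule seminorm_null_le[where u = "\<lambda>n. exp (c * r n) *\<^sub>R T (r n) (u n) - 0", OF p],
            assumption, simp only: real_seminorm_scale[OF seminorm[OF p]] diff_zero abs_exp_cancel mult_right_mono)
    qed
  qed
qed

section \<open>Resolvents and Lipschitz continuity of orbits\<close>

text \<open>\<open>m\<close> is multiplication by the spectral parameter. Passing it as an operator keeps this part of the
  theory real linear, also for a complex parameter.\<close>
definition is_resolvent :: "('a \<Rightarrow> 'a) \<Rightarrow> ('a \<Rightarrow> 'a) \<Rightarrow> bool" where
  "is_resolvent m R \<longleftrightarrow>
     (\<forall>y. gen T (R y) (m (R y) - y)) \<and> (\<forall>x z. gen T x z \<longrightarrow> R (m x - z) = x)"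

definition commuting :: "('a \<Rightarrow> 'a) \<Rightarrow> bool" where
  "commuting L \<longleftrightarrow> conv_cont L \<and> (\<forall>s\<ge>0. \<forall>x. L (T s x) = T s (L x))"

lemma commuting_conv_cont: "commuting L \<Longrightarrow> conv_cont L"
  and commuting_T: "commuting L \<Longrightarrow> 0 \<le> s \<Longrightarrow> L (T s x) = T s (L x)"
  by (simp_all add: commuting_def)

lemma commuting_scaleR: "commuting (\<lambda>x. c *\<^sub>R x)"
  using conv_cont_scaleR[OF conv_cont_id, of c] by (simp add: commuting_def blinfun.scaleR_right)

lemma gen_commuting: "gen T x y \<Longrightarrow> commuting L \<Longrightarrow> gen T (L x) (L y)"
  by (rule gen_conv_cont) (auto simp: commuting_def)

text \<open>\<open>L\<close> commutes with the generator, so both sides are mapped to \<open>L y\<close> by \<open>m\<close> minus the generator, which is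
  injective.\<close>
lemma resolvent_commute:
  assumes R: "is_resolvent m R" and L: "commuting L" and Lm: "\<And>x. L (m x) = m (L x)"
  shows "R (L y) = L (R y)"
proof -
  have "gen T (R y) (m (R y) - y)" using R by (simp add: is_resolvent_def)
  from gen_commuting[OF this L] have "gen T (L (R y)) (m (L (R y)) - L y)"
    using linear_diff[OF conv_cont_linear[OF commuting_conv_cont[OF L]]] Lm by simp
  then have "R (m (L (R y)) - (m (L (R y)) - L y)) = L (R y)"
    using R unfolding is_resolvent_def by blast
  then show ?thesis by simp
qed

definition mean :: "real \<Rightarrow> 'a \<Rightarrow> 'a" where
  "mean h x = (1 / h) *\<^sub>R orbit_integral h x"

text \<open>This is \<open>m\<close> minus the generator, applied to the mean: by \<open>gen_orbit_integral\<close> the generator sends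
  \<open>mean h x\<close> to \<open>(T h x - x) / h\<close>.\<close>
definition mean_preimage :: "('a \<Rightarrow> 'a) \<Rightarrow> real \<Rightarrow> 'a \<Rightarrow> 'a" where
  "mean_preimage m h x = m (mean h x) - (1 / h) *\<^sub>R (T h x - x)"

lemma commuting_mean:
  assumes "0 < h"
  shows "commuting (mean h)"
  using conv_cont_scaleR[OF conv_cont_orbit_integral[OF assms], of "1 / h"] assms
  by (simp add: commuting_def mean_def[abs_def] blinfun.scaleR_right orbit_integral_T)

lemma commute_mean:
  assumes "commuting L" "0 < h"
  shows "L (mean h x) = mean h (L x)"
  using assms orbit_integral_commute[OF _ commuting_conv_cont[OF assms(1)], of h x]
  by (simp add: mean_def commuting_T linear_cmul[OF conv_cont_linear[OF commuting_conv_cont]])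

lemma commuting_mean_preimage:
  assumes m: "commuting m" and h: "0 < h"
  shows "commuting (mean_preimage m h)"
proof -
  note mean = commuting_mean[OF h]
  have "conv_cont (mean_preimage m h)"
    unfolding mean_preimage_def[abs_def] using assms
    by (intro conv_cont_diff conv_cont_scaleR conv_cont_T conv_cont_id
        conv_cont_compose[OF commuting_conv_cont[OF m] commuting_conv_cont[OF mean]]) auto
  moreover have "mean_preimage m h (T s x) = T s (mean_preimage m h x)" if "0 \<le> s" for s x
    using that h T_commute[of h s x]
    by (simp add: mean_preimage_def commuting_T[OF m] commuting_T[OF mean] blinfun.diff_right
        blinfun.scaleR_right)
  ultimately show ?thesis by (simp add: commuting_def)
qed

lemma resolvent_mean_preimage:
  assumes R: "is_resolvent m R" and h: "0 < h"
  shows "R (mean_preimage m h x) = mean h x"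
proof -
  have "gen T (mean h x) ((1 / h) *\<^sub>R (T h x - x))"
    using gen_commuting[OF gen_orbit_integral[of h x] commuting_scaleR[of "1 / h"]] h by (simp add: mean_def)
  then show ?thesis
    using R by (simp add: is_resolvent_def mean_preimage_def)
qed

lemma mean_preimage_resolvent:
  assumes R: "is_resolvent m R" and m: "commuting m" and h: "0 < h"
  shows "R (mean_preimage m h x) = mean_preimage m h (R x)"
proof (rule resolvent_commute[OF R commuting_mean_preimage[OF m h]])
  fix x
  have l: "linear m" using m commuting_conv_cont conv_cont_linear by blast
  show "mean_preimage m h (m x) = m (mean_preimage m h x)"
    using h by (simp add: mean_preimage_def linear_diff[OF l] linear_cmul[OF l] commuting_T[OF m] commute_mean[OF m])
qed

text \<open>Cancels a power of the resolvent by a sequentially continuous operator, leaving a power of the mean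
  operator, which is close to the identity for small \<open>h\<close>.\<close>
lemma mean_preimage_funpow:
  assumes R: "is_resolvent m R" and m: "commuting m" and h: "0 < h"
  shows "(mean_preimage m h ^^ k) ((R ^^ k) z) = (mean h ^^ k) z"
proof (induction k arbitrary: z)
  case (Suc k)
  let ?B = "mean_preimage m h"
  have comm: "R ((?B ^^ k) w) = (?B ^^ k) (R w)" for w
    by (induction k) (simp_all add: mean_preimage_resolvent[OF R m h])
  have "(?B ^^ Suc k) ((R ^^ Suc k) z) = ?B (R ((?B ^^ k) ((R ^^ k) z)))"
    by (simp add: comm)
  also have "\<dots> = mean h ((mean h ^^ k) z)"
    by (simp add: Suc.IH resolvent_mean_preimage[OF R h] flip: mean_preimage_resolvent[OF R m h])
  finally show ?case by simp
qed simp

lemma norm_mean_le: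
  assumes "0 < h" "0 \<le> M" "\<And>s. 0 \<le> s \<Longrightarrow> s \<le> h \<Longrightarrow> norm (T s) \<le> M"
  shows "norm (mean h x) \<le> M * norm x"
  using norm_orbit_integral_le[of h M x] assms by (simp add: mean_def field_simps)

lemma norm_mean_funpow_le:
  assumes "0 < h" "0 \<le> M" "\<And>s. 0 \<le> s \<Longrightarrow> s \<le> h \<Longrightarrow> norm (T s) \<le> M"
  shows "norm ((mean h ^^ k) x) \<le> M ^ k * norm x"
proof (induction k)
  case (Suc k)
  have "norm ((mean h ^^ Suc k) x) \<le> M * norm ((mean h ^^ k) x)"
    using norm_mean_le[OF assms] by simp
  also have "\<dots> \<le> M * (M ^ k * norm x)"
    using Suc assms(2) by (intro mult_left_mono)
  finally show ?case by (simp add: mult.assoc)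
qed simp

lemma conv_mean_funpow:
  assumes "\<And>n. 0 < r n" "r \<longlonglongrightarrow> 0"
  shows "conv (\<lambda>n. (mean (r n) ^^ k) x) x"
proof (induction k)
  case 0
  then show ?case by (simp add: conv_const)
next
  case (Suc k)
  then show ?case
    using conv_mean[OF Suc assms] by (simp add: mean_def)
qed

text \<open>The estimate for \<open>R (y n)\<close>, on which the generator is bounded, survives in two limits by lower
  semicontinuity of the norm: \<open>n\<close> to infinity for a fixed smoothing length \<open>h\<close>, then \<open>h\<close> to \<open>0\<close>. The order
  matters, since the operator that cancels \<open>R ^^ k\<close> need not be bounded uniformly in \<open>h\<close>.\<close>
proposition orbit_Lipschitz_of_resolvent_limit:
  assumes R: "is_resolvent m R" and m: "commuting m"
    and bd: "bounded (range (\<lambda>n. m (R (y n)) - y n))"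
    and lim: "conv (\<lambda>n. (R ^^ (k + 1)) (y n)) ((R ^^ k) x)"
  shows "\<exists>C. \<forall>t. 0 \<le> t \<and> t \<le> 1 \<longrightarrow> norm (T t x - x) \<le> C * t"
proof -
  obtain M where M: "0 \<le> M" "\<And>s. 0 \<le> s \<Longrightarrow> s \<le> 1 \<Longrightarrow> norm (T s) \<le> M"
    using T_bounded by blast
  obtain D where D: "norm (m (R (y n)) - y n) \<le> D" for n
    using bd by (auto simp: bounded_iff)
  have "norm (T t x - x) \<le> (M ^ k * (M * D)) * t" if t: "0 \<le> t" "t \<le> 1" for t
  proof -
    have step: "norm ((mean h ^^ k) (T t x - x)) \<le> (M ^ k * (M * D)) * t" if h: "0 < h" "h \<le> 1" for h
    proof -
      let ?J = "mean h ^^ k"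
      have J: "conv_cont ?J" "linear ?J"
        using conv_cont_funpow[OF commuting_conv_cont[OF commuting_mean[OF h(1)]]] conv_cont_linear
        by blast+
      have JT: "?J (T t w) = T t (?J w)" for w
        using commuting_T[OF commuting_mean[OF h(1)] t(1)] by (induction k) auto
      have "conv_cont (mean_preimage m h ^^ k)"
        using conv_cont_funpow[OF commuting_conv_cont[OF commuting_mean_preimage[OF m h(1)]]] .
      from conv_cont_conv[OF this lim] have "conv (\<lambda>n. ?J (R (y n))) (?J x)"
        using mean_preimage_funpow[OF R m h(1), of k] by (simp add: funpow_swap1)
      then have "conv (\<lambda>n. T t (?J (R (y n))) - ?J (R (y n))) (T t (?J x) - ?J x)"
        by (intro conv_diff conv_cont_conv[OF conv_cont_T] t)
      then have "conv (\<lambda>n. ?J (T t (R (y n)) - R (y n))) (?J (T t x - x))"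
        by (simp add: linear_diff[OF J(2)] JT)
      then show ?thesis
      proof (rule norm_lsc)
        fix n
        have "norm (?J (T t (R (y n)) - R (y n))) \<le> M ^ k * norm (T t (R (y n)) - R (y n))"
          using M h by (intro norm_mean_funpow_le) auto
        also have "\<dots> \<le> M ^ k * (t * (M * norm (m (R (y n)) - y n)))"
          using R M t by (intro mult_left_mono gen_imp_norm_le) (auto simp: is_resolvent_def)
        also have "\<dots> \<le> M ^ k * (t * (M * D))"
          using M(1) t D by (intro mult_left_mono) auto
        finally show "norm (?J (T t (R (y n)) - R (y n))) \<le> (M ^ k * (M * D)) * t"
          by (simp add: ac_simps)
      qed
    qed
    let ?r = "\<lambda>n. inverse (real (Suc n))"
    have "conv (\<lambda>n. (mean (?r n) ^^ k) (T t x - x)) (T t x - x)"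
      by (rule conv_mean_funpow) (simp, rule LIMSEQ_inverse_real_of_nat)
    then show ?thesis
      by (rule norm_lsc) (intro step; simp add: inverse_eq_divide)
  qed
  then show ?thesis by blast
qed

text \<open>The means over shrinking intervals tend to \<open>x\<close>, and their preimages under the resolvent contain the
  difference quotients of the orbit at \<open>0\<close>, which are bounded.\<close>
proposition resolvent_limit_of_orbit_Lipschitz:
  assumes R: "is_resolvent m R" and m: "\<And>x. norm (m x) \<le> c * norm x"
    and "0 < d" and lip: "\<And>t. 0 < t \<Longrightarrow> t < d \<Longrightarrow> norm (T t x - x) \<le> C * t"
  shows "\<exists>y::nat \<Rightarrow> 'a. bounded (range y) \<and> conv (\<lambda>n. R (y n)) x"
proof (intro exI conjI)
  define r where "r n = d * inverse (real (Suc (Suc n)))" for n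
  have r: "0 < r n" "r n < d" for n
    using \<open>0 < d\<close> mult_strict_left_mono[of "inverse (real (Suc (Suc n)))" 1 d]
    by (auto simp: r_def inverse_less_1_iff)
  have "r \<longlonglongrightarrow> d * 0"
    unfolding r_def by (intro tendsto_mult tendsto_const LIMSEQ_Suc[OF LIMSEQ_inverse_real_of_nat])
  then have r0: "r \<longlonglongrightarrow> 0" by simp
  obtain M where M: "0 \<le> M" "\<And>s. 0 \<le> s \<Longrightarrow> s \<le> d \<Longrightarrow> norm (T s) \<le> M"
    using T_bounded by blast
  have "norm (mean_preimage m (r n) x) \<le> \<bar>c\<bar> * (M * norm x) + C" for n
  proof -
    have "norm (mean (r n) x) \<le> M * norm x"
      using r[of n] M by (intro norm_mean_le) auto
    then have "norm (m (mean (r n) x)) \<le> \<bar>c\<bar> * (M * norm x)"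
      by (intro order_trans[OF m] mult_mono) auto
    moreover have "norm ((1 / r n) *\<^sub>R (T (r n) x - x)) \<le> C"
      using lip[OF r, of n] r(1)[of n] by (simp add: pos_divide_le_eq)
    ultimately show ?thesis
      unfolding mean_preimage_def
      using norm_triangle_ineq4[of "m (mean (r n) x)" "(1 / r n) *\<^sub>R (T (r n) x - x)"] by linarith
  qed
  then show "bounded (range (\<lambda>n. mean_preimage m (r n) x))"
    unfolding bounded_iff by blast
  show "conv (\<lambda>n. R (mean_preimage m (r n) x)) x"
    using conv_mean_funpow[of r 1 x] r r0 by (simp add: resolvent_mean_preimage[OF R r(1)])
qed

section \<open>Existence of a resolvent\<close>

text \<open>Sequential continuity does not follow from that of the partial sums of the Neumann series alone: the
  remainder \<open>S ^^ K\<close> applied to \<open>N (u n)\<close> is small in norm, uniformly in \<open>n\<close>, because \<open>N (u n)\<close> is bounded.\<close>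
lemma Neumann_inverse:
  fixes S :: "'a \<Rightarrow>\<^sub>L 'a"
  assumes S: "norm S < 1" and cc: "conv_cont (\<lambda>x. S x)"
  obtains N where "bounded_linear N" "conv_cont N" "\<And>y w. N y = w \<longleftrightarrow> w - S w = y"
proof -
  have ex1: "\<exists>!w. w - S w = y" for y
  proof -
    have "\<exists>!w. y + S w = w"
    proof (rule banach_fix_type[where c = "norm S"])
      show "\<forall>v w. dist (y + S v) (y + S w) \<le> norm S * dist v w"
        by (simp add: dist_norm norm_blinfun flip: blinfun.diff_right)
    qed (use S in auto)
    moreover have "y + S w = w \<longleftrightarrow> w - S w = y" for w
      by (auto simp: algebra_simps)
    ultimately show ?thesis by simp
  qed
  define N where "N y = (THE w. w - S w = y)" for y
  have N: "N y = w \<longleftrightarrow> w - S w = y" for y w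
    unfolding N_def using theI'[OF ex1[of y]] the1_equality[OF ex1[of y], of w] by blast
  have Neq: "N y - S (N y) = y" for y
    using N by blast
  have lin: "linear N"
  proof (rule linearI)
    show "N (x + y) = N x + N y" for x y
      by (subst N) (use arg_cong2[OF Neq[of x] Neq[of y], of "(+)"] in \<open>simp only: blinfun.add_right add_diff_add\<close>)
    show "N (c *\<^sub>R x) = c *\<^sub>R N x" for c x
      by (subst N) (use Neq[of x] in \<open>simp add: blinfun.scaleR_right flip: scaleR_diff_right\<close>)
  qed
  have bound: "norm (N y) \<le> norm y * (1 / (1 - norm S))" for y
  proof -
    have "norm (N y) \<le> norm y + norm (S (N y))"
      using norm_triangle_ineq[of y "S (N y)"] Neq[of y] by (simp add: algebra_simps)
    also have "\<dots> \<le> norm y + norm S * norm (N y)"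
      by (simp add: norm_blinfun)
    finally have "norm (N y) * (1 - norm S) \<le> norm y"
      by (simp add: algebra_simps)
    then show ?thesis using S by (simp add: pos_le_divide_eq)
  qed
  have "conv_cont N"
  proof (rule conv_contI_null[OF lin])
    fix u assume u: "conv u 0"
    \<comment> \<open>\<open>e\<close> is the partial sum of the Neumann series at \<open>u n\<close>, with \<open>K\<close> terms.\<close>
    have split: "\<exists>e. conv e 0 \<and> (\<forall>n. N (u n) = e n + ((\<lambda>x. S x) ^^ K) (N (u n)))" for K
    proof (induction K)
      case 0
      show ?case by (intro exI[of _ "\<lambda>_. 0"]) (simp add: conv_const)
    next
      case (Suc K)
      then obtain e where e: "conv e 0" "\<And>n. N (u n) = e n + ((\<lambda>x. S x) ^^ K) (N (u n))" by blast
      have "N (u n) = (u n + S (e n)) + ((\<lambda>x. S x) ^^ Suc K) (N (u n))" for n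
        using arg_cong[OF e(2)[of n], of "\<lambda>x. u n + S x"] Neq[of "u n"]
        by (simp add: blinfun.add_right algebra_simps)
      moreover have "conv (\<lambda>n. u n + S (e n)) (0 + S 0)"
        by (intro conv_add u conv_cont_conv[OF cc] e)
      ultimately show ?case by auto
    qed
    obtain U where U: "norm (u n) \<le> U" for n
      using conv_bounded[OF u] by (auto simp: bounded_iff)
    define W where "W = U * (1 / (1 - norm S))"
    have W: "norm (N (u n)) \<le> W" for n
      unfolding W_def using S by (intro order_trans[OF bound] mult_right_mono U) auto
    have power_le: "norm (((\<lambda>x. S x) ^^ K) z) \<le> norm S ^ K * norm z" for K z
    proof (induction K)
      case (Suc K)
      have "norm (((\<lambda>x. S x) ^^ Suc K) z) \<le> norm S * norm (((\<lambda>x. S x) ^^ K) z)"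
        by (simp add: norm_blinfun)
      also have "\<dots> \<le> norm S * (norm S ^ K * norm z)"
        using Suc by (intro mult_left_mono) auto
      finally show ?case by (simp add: mult.assoc)
    qed simp
    show "conv (\<lambda>n. N (u n)) 0"
      unfolding conv_def
    proof (intro conjI ballI)
      show "bounded (range (\<lambda>n. N (u n)))" using W by (auto simp: bounded_iff)
      fix p assume p: "p \<in> P"
      show "(\<lambda>n. p (N (u n) - 0)) \<longlonglongrightarrow> 0"
      proof (rule tendstoI)
        fix e :: real assume "0 < e"
        have "(\<lambda>K. norm S ^ K * W) \<longlonglongrightarrow> 0 * W"
          by (intro tendsto_mult LIMSEQ_power_zero tendsto_const) (use S in simp)
        then have "eventually (\<lambda>K. norm S ^ K * W < e / 2) sequentially"
          using \<open>0 < e\<close> by (intro order_tendstoD(2)[of _ 0]) auto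
        then obtain K where K: "norm S ^ K * W < e / 2"
          using eventually_happens' sequentially_bot by blast
        obtain v where v: "conv v 0" "\<And>n. N (u n) = v n + ((\<lambda>x. S x) ^^ K) (N (u n))"
          using split[of K] by blast
        have "eventually (\<lambda>n. p (v n) < e / 2) sequentially"
          using null_seminorm[OF v(1) p] \<open>0 < e\<close> by (intro order_tendstoD(2)[of _ 0]) auto
        then show "eventually (\<lambda>n. dist (p (N (u n) - 0)) 0 < e) sequentially"
        proof (rule eventually_mono)
          fix n assume "p (v n) < e / 2"
          let ?z = "((\<lambda>x. S x) ^^ K) (N (u n))"
          have "p ?z \<le> norm S ^ K * norm (N (u n))"
            using le_norm[OF p] power_le order_trans by blast
          also have "\<dots> \<le> norm S ^ K * W"
            using W by (intro mult_left_mono) auto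
          finally have "p ?z < e / 2" using K by simp
          with \<open>p (v n) < e / 2\<close> have "p (v n + ?z) < e"
            using real_seminorm_add[OF seminorm[OF p], of "v n" ?z] by linarith
          then have "p (N (u n)) < e" using v(2)[of n] by simp
          then show "dist (p (N (u n) - 0)) 0 < e"
            using real_seminorm_nonneg[OF seminorm[OF p]] by (simp add: dist_real_def)
        qed
      qed
    qed
  qed
  moreover have "bounded_linear N"
    by (rule bounded_linear_intro[OF linear_add[OF lin] linear_cmul[OF lin] bound])
  ultimately show ?thesis using that N by blast
qed

text \<open>With \<open>S s = exp (- c s) T s\<close>, whose generator is \<open>A - c\<close>, the integral \<open>I\<close> of \<open>S\<close> over \<open>[0, 1]\<close> satisfies
  \<open>(c - A) I = 1 - S 1\<close>, and \<open>I (c - A) = 1 - S 1\<close> on the domain of \<open>A\<close>. The resolvent is therefore \<open>I\<close>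
  composed with the inverse of \<open>1 - S 1\<close>.\<close>
proposition ex_resolvent:
  assumes "norm (exp (- c) *\<^sub>R T 1) < 1"
  shows "\<exists>R. bounded_linear R \<and> conv_cont R \<and> is_resolvent (\<lambda>x. c *\<^sub>R x) R"
proof -
  define S where "S = (\<lambda>s. exp (- c * s) *\<^sub>R T s)"
  interpret S: seminorm_bicontinuous_semigroup P S
    unfolding S_def by (rule rescaled)
  have "conv_cont (\<lambda>x. S 1 x)" by (rule S.conv_cont_T) simp
  then obtain N where N: "bounded_linear N" "conv_cont N" "\<And>y w. N y = w \<longleftrightarrow> w - S 1 w = y"
    using Neumann_inverse[of "S 1"] assms by (auto simp: S_def)
  have Neq: "N y - S 1 (N y) = y" for y using N(3) by blast
  have NS: "N (S s x) = S s (N x)" if "0 \<le> s" for s x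
    using N(3)[of "S s x" "S s (N x)"] Neq[of x] S.T_commute[of 1 s "N x"] that
    by (simp flip: blinfun.diff_right)
  define R where "R y = S.orbit_integral 1 (N y)" for y
  have cont: "conv_cont R"
    unfolding R_def[abs_def] by (intro conv_cont_compose[OF S.conv_cont_orbit_integral N(2)]) simp
  have "bounded_linear (S.orbit_integral 1)"
  proof -
    obtain M where "0 \<le> M" "\<And>s. 0 \<le> s \<Longrightarrow> s \<le> 1 \<Longrightarrow> norm (S s) \<le> M"
      using S.T_bounded by blast
    then have "norm (S.orbit_integral 1 x) \<le> norm x * M" for x
      using S.norm_orbit_integral_le[of 1 M x] by (simp add: mult.commute)
    then show ?thesis
      using linear_add linear_cmul S.linear_orbit_integral[of 1] by (intro bounded_linear_intro) auto
  qed
  then have "bounded_linear R"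
    using bounded_linear_compose N(1) unfolding R_def[abs_def] by blast
  moreover have "gen T (R y) (c *\<^sub>R R y - y)" for y
  proof -
    have "gen S (R y) (S 1 (N y) - N y)"
      unfolding R_def by (rule S.gen_orbit_integral) simp
    from gen_rescale[OF this, of c] have "gen (\<lambda>s. exp (c * s) *\<^sub>R S s) (R y) (- y + c *\<^sub>R R y)"
      using Neq[of y] by (metis minus_diff_eq)
    moreover have "(\<lambda>s. exp (c * s) *\<^sub>R S s) = T"
      by (simp add: S_def fun_eq_iff flip: exp_add)
    ultimately show ?thesis by simp
  qed
  moreover have "R (c *\<^sub>R x - z) = x" if "gen T x z" for x z
  proof -
    have "gen S x (z - c *\<^sub>R x)"
      using gen_rescale[OF that, of "- c"] by (simp add: S_def)
    then have I: "S.orbit_integral 1 (z - c *\<^sub>R x) = S 1 x - x"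
      by (intro S.gen_imp_orbit_integral) auto
    have "R (c *\<^sub>R x - z) = N (S.orbit_integral 1 (c *\<^sub>R x - z))"
      unfolding R_def using S.orbit_integral_commute[of 1 N] N(2) NS by simp
    also have "S.orbit_integral 1 (c *\<^sub>R x - z) = x - S 1 x"
      using I linear_neg[OF S.linear_orbit_integral[of 1], of "z - c *\<^sub>R x"] by simp
    also have "N (x - S 1 x) = x" using N(3) by blast
    finally show ?thesis .
  qed
  ultimately show ?thesis
    using cont by (auto simp: is_resolvent_def)
qed

end

section \<open>Topologies generated by seminorms\<close>

lemma openin_seminorm_ball:
  "p \<in> P \<Longrightarrow> 0 < e \<Longrightarrow> openin (seminorm_topology P) {y. p (y - x) < e}"
  unfolding seminorm_topology_def by (rule topology_generated_by_Basis) blast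

lemma topspace_seminorm_topology:
  assumes "P \<noteq> {}" "\<And>p. p \<in> P \<Longrightarrow> real_seminorm p"
  shows "topspace (seminorm_topology P) = UNIV"
proof -
  have "x \<in> \<Union> {{y. p (y - x) < e} |p x e. p \<in> P \<and> 0 < e}" for x
  proof -
    obtain p where "p \<in> P" using assms(1) by blast
    then have "x \<in> {y. p (y - x) < 1}" using assms(2) by (simp add: real_seminorm_zero)
    moreover have "{y. p (y - x) < 1} \<in> {{y. p (y - x) < e} |p x e. p \<in> P \<and> 0 < e}"
      using \<open>p \<in> P\<close> zero_less_one by blast
    ultimately show ?thesis by (rule UnionI[rotated])
  qed
  then show ?thesis unfolding seminorm_topology_def by auto
qed

lemma limitin_seminorm_topology_iff:
  assumes P: "P \<noteq> {}" "\<And>p. p \<in> P \<Longrightarrow> real_seminorm p"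
  shows "limitin (seminorm_topology P) u l F \<longleftrightarrow> (\<forall>p\<in>P. ((\<lambda>n. p (u n - l)) \<longlongrightarrow> 0) F)"
proof
  assume lim: "limitin (seminorm_topology P) u l F"
  show "\<forall>p\<in>P. ((\<lambda>n. p (u n - l)) \<longlongrightarrow> 0) F"
  proof (intro ballI tendstoI)
    fix p and e :: real assume p: "p \<in> P" "0 < e"
    have "l \<in> {y. p (y - l) < e}"
      using p P(2)[OF p(1)] by (simp add: real_seminorm_zero)
    then have "eventually (\<lambda>n. u n \<in> {y. p (y - l) < e}) F"
      using lim openin_seminorm_ball[OF p, of l] unfolding limitin_def by blast
    then show "eventually (\<lambda>n. dist (p (u n - l)) 0 < e) F"
      using real_seminorm_nonneg[OF P(2)[OF p(1)]] by (simp add: dist_real_def)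
  qed
next
  assume conv: "\<forall>p\<in>P. ((\<lambda>n. p (u n - l)) \<longlongrightarrow> 0) F"
  have "l \<in> U \<longrightarrow> eventually (\<lambda>n. u n \<in> U) F" if "openin (seminorm_topology P) U" for U
    using openin_topology_generated_by[OF that[unfolded seminorm_topology_def]]
  proof (induction rule: generate_topology_on.induct)
    case (Int a b)
    then show ?case by (auto intro: eventually_conj)
  next
    case (UN K)
    show ?case
    proof
      assume "l \<in> \<Union> K"
      then obtain k where "k \<in> K" "l \<in> k" by blast
      with UN have "eventually (\<lambda>n. u n \<in> k) F" by blast
      then show "eventually (\<lambda>n. u n \<in> \<Union> K) F"
        by (rule eventually_mono) (use \<open>k \<in> K\<close> in blast)
    qed
  next
    case (Basis s)
    then obtain p x e where s: "s = {y. p (y - x) < e}" "p \<in> P" by blast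
    show ?case
    proof
      assume "l \<in> s"
      then have "eventually (\<lambda>n. p (u n - l) < e - p (l - x)) F"
        using conv s by (intro order_tendstoD(2)[of _ 0]) auto
      then show "eventually (\<lambda>n. u n \<in> s) F"
      proof (rule eventually_mono)
        fix n assume "p (u n - l) < e - p (l - x)"
        then have "p (u n - x) < e"
          using real_seminorm_triangle[OF P(2)[OF s(2)], of "u n" x l] by linarith
        then show "u n \<in> s" using s(1) by blast
      qed
    qed
  qed auto
  then show "limitin (seminorm_topology P) u l F"
    unfolding limitin_def using topspace_seminorm_topology[OF P] by simp
qed

lemma seminorm_over_imp_real_seminorm:
  assumes "banach_space_over smul" "seminorm_over smul p"
  shows "real_seminorm p"
proof -
  interpret banach_space_over smul by fact
  have "p (a *\<^sub>R x) = \<bar>a\<bar> * p x" for a x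
    using assms(2) scale_of_real[of a x] unfolding seminorm_over_def by (metis norm_of_real)
  then show ?thesis
    using assms(2) by (simp add: real_seminorm_def seminorm_over_def)
qed

lemma linear_topology_seminorm_topology:
  assumes over: "banach_space_over smul" and P: "P \<noteq> {}" "\<And>p. p \<in> P \<Longrightarrow> seminorm_over smul p"
  shows "linear_topology smul (seminorm_topology P)"
  unfolding linear_topology_def
proof (intro conjI)
  interpret banach_space_over smul by (fact over)
  note rs = seminorm_over_imp_real_seminorm[OF over P(2)]
  let ?T = "seminorm_topology P"
  show top: "topspace ?T = UNIV"
    using topspace_seminorm_topology[OF P(1) rs] .
  have sub: "continuous_map X ?T f"
    if "\<And>p e a. p \<in> P \<Longrightarrow> 0 < e \<Longrightarrow> openin X (f -` {y. p (y - a) < e} \<inter> topspace X)" for X :: "'c topology" and f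
    unfolding seminorm_topology_def
  proof (rule continuous_on_generated_topo)
    show "f ` topspace X \<subseteq> \<Union> {{y. p (y - x) < e} |p x e. p \<in> P \<and> 0 < e}"
      using top unfolding seminorm_topology_def by simp
  qed (use that in blast)
  show "continuous_map (prod_topology ?T ?T) ?T (\<lambda>(x, y). x + y)"
  proof (rule sub)
    fix p and e :: real and a assume p: "p \<in> P" and "0 < e"
    note s = rs[OF p]
    show "openin (prod_topology ?T ?T) ((\<lambda>(x, y). x + y) -` {y. p (y - a) < e} \<inter> topspace (prod_topology ?T ?T))"
      unfolding openin_prod_topology_alt
    proof (intro allI impI)
      fix x y assume "(x, y) \<in> (\<lambda>(x, y). x + y) -` {y. p (y - a) < e} \<inter> topspace (prod_topology ?T ?T)"
      then have lt: "p (x + y - a) < e" by simp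
      define d where "d = (e - p (x + y - a)) / 2"
      have d: "0 < d" using lt by (simp add: d_def)
      have "p (x' + y' - a) < e" if "p (x' - x) < d" "p (y' - y) < d" for x' y'
      proof -
        have "p (x' + y' - (x + y)) \<le> p (x' - x) + p (y' - y)"
          using real_seminorm_add[OF s, of "x' - x" "y' - y"] by (simp only: add_diff_add)
        then show ?thesis
          using real_seminorm_triangle[OF s, of "x' + y'" a "x + y"] that unfolding d_def by argo
      qed
      then show "\<exists>U V. openin ?T U \<and> openin ?T V \<and> x \<in> U \<and> y \<in> V \<and>
          U \<times> V \<subseteq> (\<lambda>(x, y). x + y) -` {y. p (y - a) < e} \<inter> topspace (prod_topology ?T ?T)"
        using openin_seminorm_ball[OF p d] d
        by (intro exI[of _ "{x'. p (x' - x) < d}"] exI[of _ "{y'. p (y' - y) < d}"])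
          (auto simp: top real_seminorm_zero[OF s])
    qed
  qed
  show "continuous_map (prod_topology euclidean ?T) ?T (\<lambda>(c, x). smul c x)"
  proof (rule sub)
    fix p and e :: real and a assume p: "p \<in> P" and "0 < e"
    note s = rs[OF p]
    have ps: "p (smul c x) = norm c * p x" for c x
      using P(2)[OF p] by (simp add: seminorm_over_def)
    show "openin (prod_topology euclidean ?T)
        ((\<lambda>(c, x). smul c x) -` {y. p (y - a) < e} \<inter> topspace (prod_topology euclidean ?T))"
      unfolding openin_prod_topology_alt
    proof (intro allI impI)
      fix c x assume "(c, x) \<in> (\<lambda>(c, x). smul c x) -` {y. p (y - a) < e} \<inter> topspace (prod_topology euclidean ?T)"
      then have lt: "p (smul c x - a) < e" by simp
      define K where "K = 1 + p x + norm c"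
      define d where "d = min 1 ((e - p (smul c x - a)) / K)"
      have px: "0 \<le> p x" by (rule real_seminorm_nonneg[OF s])
      then have K: "0 < K" by (simp add: K_def add_pos_nonneg)
      have d: "0 < d" "d \<le> 1" "d * K \<le> e - p (smul c x - a)"
        using lt K by (auto simp: d_def min_def field_simps)
      have "p (smul c' x' - a) < e" if c': "norm (c' - c) < d" and x': "p (x' - x) < d" for c' x'
      proof -
        have eq: "smul c' x' - smul c x = smul (c' - c) (x' - x) + smul (c' - c) x + smul c (x' - x)"
          by (simp add: algebra_simps)
        have "p (smul c' x' - smul c x) \<le> p (smul (c' - c) (x' - x)) + p (smul (c' - c) x) + p (smul c (x' - x))"
          unfolding eq
          using real_seminorm_add[OF s, of "smul (c' - c) (x' - x) + smul (c' - c) x" "smul c (x' - x)"]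
            real_seminorm_add[OF s, of "smul (c' - c) (x' - x)" "smul (c' - c) x"]
          by linarith
        also have "\<dots> = norm (c' - c) * p (x' - x) + norm (c' - c) * p x + norm c * p (x' - x)"
          by (simp add: ps)
        also have "\<dots> < d * 1 + d * p x + d * norm c"
        proof -
          have "norm (c' - c) * p (x' - x) < d * 1"
            using c' x' d by (intro mult_strict_mono') (auto simp: real_seminorm_nonneg[OF s])
          moreover have "norm (c' - c) * p x \<le> d * p x" "norm c * p (x' - x) \<le> d * norm c"
            using c' x' px by (auto simp: mult_right_mono mult.commute[of d "norm c"] mult_left_mono)
          ultimately show ?thesis by linarith
        qed
        also have "\<dots> = d * K" by (simp add: K_def algebra_simps)
        finally show ?thesis
          using real_seminorm_triangle[OF s, of "smul c' x'" a "smul c x"] d(3) by linarith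
      qed
      then show "\<exists>U V. openin euclidean U \<and> openin ?T V \<and> c \<in> U \<and> x \<in> V \<and>
          U \<times> V \<subseteq> (\<lambda>(c, x). smul c x) -` {y. p (y - a) < e} \<inter> topspace (prod_topology euclidean ?T)"
        using openin_seminorm_ball[OF p d(1)] d(1)
        by (intro exI[of _ "ball c d"] exI[of _ "{x'. p (x' - x) < d}"])
          (auto simp: top real_seminorm_zero[OF s] dist_norm norm_minus_commute)
    qed
  qed
qed

text \<open>The bounds on \<open>p\<close> and \<open>w\<close> make the supremum finite.\<close>
lemma seminorm_SUP:
  fixes p :: "nat \<Rightarrow> 'a::banach \<Rightarrow> real" and w :: "nat \<Rightarrow> real"
  assumes over: "banach_space_over smul" and p: "\<And>k. seminorm_over smul (p k)"
    and le: "\<And>k x. p k x \<le> norm x" and w: "\<And>k. 0 \<le> w k" "\<And>k. w k \<le> 1"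
    and q: "\<And>x. q x = (SUP k. w k * p k x)"
  shows "seminorm_over smul q" "w k * p k x \<le> q x" "(\<And>k. w k * p k x \<le> c) \<Longrightarrow> q x \<le> c"
proof -
  interpret banach_space_over smul by (fact over)
  have nonneg: "0 \<le> p k x" for k x using p by (simp add: seminorm_over_def)
  have ub: "w k * p k x \<le> norm x" for k x
    using mult_mono[OF w(2)[of k] le[of k x]] nonneg by simp
  then have "bdd_above (range (\<lambda>k. w k * p k x))" for x
    by (intro bdd_aboveI[of _ "norm x"]) auto
  then show upper: "w k * p k x \<le> q x" for k x
    unfolding q by (intro cSUP_upper) auto
  show least: "q x \<le> c" if "\<And>k. w k * p k x \<le> c" for x c
    unfolding q using that by (intro cSUP_least) auto
  have q0: "0 \<le> q x" for x
    using order_trans[OF mult_nonneg_nonneg[OF w(1) nonneg] upper] .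
  have scale_le: "q (smul c x) \<le> norm c * q x" for c x
  proof (rule least)
    fix k
    have "w k * p k (smul c x) = norm c * (w k * p k x)"
      using p by (simp add: seminorm_over_def)
    then show "w k * p k (smul c x) \<le> norm c * q x"
      using mult_left_mono[OF upper[of k x] norm_ge_zero[of c]] by linarith
  qed
  have "norm c * q x \<le> q (smul c x)" for c x
  proof (cases "c = 0")
    case False
    have "q x = q (smul (inverse c) (smul c x))" using False by simp
    also have "\<dots> \<le> norm (inverse c) * q (smul c x)" by (rule scale_le)
    finally have "norm c * q x \<le> norm c * (norm (inverse c) * q (smul c x))"
      by (simp add: mult_left_mono)
    also have "\<dots> = q (smul c x)" using False by (simp add: norm_inverse)
    finally show ?thesis .
  qed (use q0 in simp)
  moreover have "q (x + y) \<le> q x + q y" for x y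
  proof (rule least)
    fix k
    have "w k * p k (x + y) \<le> w k * (p k x + p k y)"
      using p w(1) by (intro mult_left_mono) (auto simp: seminorm_over_def)
    then show "w k * p k (x + y) \<le> q x + q y"
      using upper[of k x] upper[of k y] by (simp add: distrib_left)
  qed
  ultimately show "seminorm_over smul q"
    using q0 scale_le by (simp add: seminorm_over_def antisym)
qed

section \<open>Sequential convergence in the mixed topology\<close>

locale mixed_saks =
  fixes smul :: "'k::real_or_complex \<Rightarrow> 'a::banach \<Rightarrow> 'a"
    and \<tau> \<gamma> :: "'a topology" and P :: "('a \<Rightarrow> real) set"
  assumes over: "banach_space_over smul"
    and directed: "directed_seminorms smul P"
    and tau: "\<tau> = seminorm_topology P"
    and norm_SUP: "bdd_above ((\<lambda>p. p x) ` P) \<and> norm x = (SUP p\<in>P. p x)"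
    and mixed: "is_mixed_topology smul \<tau> \<gamma>"
    and seq_complete: "seq_complete_on \<gamma> UNIV"
begin

sublocale banach_space_over smul by (fact over)

lemma P_nonempty: "P \<noteq> {}" and P_over: "p \<in> P \<Longrightarrow> seminorm_over smul p"
  using directed by (auto simp: directed_seminorms_def)

lemma P_real: "p \<in> P \<Longrightarrow> real_seminorm p"
  using seminorm_over_imp_real_seminorm[OF over P_over] .

lemma P_le_norm: "p \<in> P \<Longrightarrow> p x \<le> norm x"
  using norm_SUP[of x] by (metis (no_types, lifting) cSUP_upper)

lemma P_norm_leI: "(\<And>p. p \<in> P \<Longrightarrow> p x \<le> c) \<Longrightarrow> norm x \<le> c"
  using norm_SUP[of x] P_nonempty by (metis (no_types, lifting) cSUP_least)

lemma limitin_tau: "limitin \<tau> u l F \<longleftrightarrow> (\<forall>p\<in>P. ((\<lambda>n. p (u n - l)) \<longlongrightarrow> 0) F)"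
  unfolding tau by (rule limitin_seminorm_topology_iff[OF P_nonempty P_real])

text \<open>On a set of norm bound \<open>C\<close> all but finitely many of the terms \<open>p k / (k + 1)\<close> of \<open>q\<close> are small, so \<open>q\<close> is
  controlled there by finitely many members of \<open>P\<close>.\<close>
lemma mixed_candidate_insert:
  fixes p :: "nat \<Rightarrow> 'a \<Rightarrow> real"
  assumes p: "\<And>k. p k \<in> P"
  defines "q \<equiv> \<lambda>x. SUP k. inverse (real (Suc k)) * p k x"
  shows "mixed_candidate smul \<tau> (seminorm_topology (insert q P))"
proof -
  let ?Q = "seminorm_topology (insert q P)"
  have w: "0 \<le> inverse (real (Suc k))" "inverse (real (Suc k)) \<le> 1" for k
    by (auto simp: field_simps)
  have q_eq: "q x = (SUP k. inverse (real (Suc k)) * p k x)" for x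
    by (simp add: q_def)
  note q_facts = seminorm_SUP[where p = p and w = "\<lambda>k. inverse (real (Suc k))",
      OF over P_over[OF p] P_le_norm[OF p] w q_eq]
  have q_real: "real_seminorm q"
    using seminorm_over_imp_real_seminorm[OF over q_facts(1)] .
  have pq_real: "r \<in> insert q P \<Longrightarrow> real_seminorm r" for r
    using q_real P_real by blast
  have weight: "inverse (real (Suc k)) * p k x \<le> p k x" for k x
    using real_seminorm_nonneg[OF P_real[OF p], of k x] w[of k] by (simp add: mult_left_le_one_le)
  have "q x \<le> norm x" for x
    by (rule q_facts(3)) (use weight P_le_norm[OF p] order_trans in blast)
  then have le: "r \<in> insert q P \<Longrightarrow> r x \<le> norm x" for r x
    using P_le_norm by blast
  have coarser: "coarser_eq \<tau> ?Q"
    unfolding coarser_eq_def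
  proof (intro allI impI)
    fix U assume "openin \<tau> U"
    then have "continuous_map ?Q \<tau> id \<longrightarrow> openin ?Q U"
      using topspace_seminorm_topology[OF _ pq_real] by (force simp: continuous_map_def)
    moreover have "continuous_map ?Q \<tau> id"
      unfolding tau seminorm_topology_def[of P]
    proof (rule continuous_on_generated_topo)
      show "openin ?Q (id -` U \<inter> topspace ?Q)" if "U \<in> {{y. p (y - x) < e} |p x e. p \<in> P \<and> 0 < e}" for U
        using that openin_seminorm_ball[of _ "insert q P"] by auto
      show "id ` topspace ?Q \<subseteq> \<Union> {{y. p (y - x) < e} |p x e. p \<in> P \<and> 0 < e}"
        using topspace_seminorm_topology[OF P_nonempty P_real] unfolding seminorm_topology_def by simp
    qed
    ultimately show "openin ?Q U" by blast
  qed
  have "coarser_eq ?Q euclidean"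
    unfolding coarser_eq_def
  proof (intro allI impI)
    fix U assume "openin ?Q U"
    have "open U"
      using openin_topology_generated_by[OF \<open>openin ?Q U\<close>[unfolded seminorm_topology_def]]
    proof (induction rule: generate_topology_on.induct)
      case (Basis s)
      then obtain r x e where s: "s = {y. r (y - x) < e}" "r \<in> insert q P" by blast
      show "open s"
      proof (rule openI)
        fix y assume "y \<in> s"
        then have "0 < e - r (y - x)" using s by simp
        moreover have "ball y (e - r (y - x)) \<subseteq> s"
        proof
          fix z assume "z \<in> ball y (e - r (y - x))"
          then have "norm (z - y) < e - r (y - x)" by (simp add: dist_norm norm_minus_commute)
          then show "z \<in> s"
            using s le[OF s(2), of "z - y"] real_seminorm_triangle[OF pq_real[OF s(2)], of z x y] by simp
        qed
        ultimately show "\<exists>t>0. ball y t \<subseteq> s" by blast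
      qed
    qed auto
    then show "openin euclidean U" by simp
  qed
  moreover have "subtopology ?Q B = subtopology \<tau> B" if "bounded B" for B
    unfolding topology_eq
  proof (intro allI iffI)
    fix S assume "openin (subtopology \<tau> B) S"
    then show "openin (subtopology ?Q B) S"
      using coarser by (auto simp: openin_subtopology coarser_eq_def)
  next
    obtain C where C: "norm x \<le> C" if "x \<in> B" for x
      using \<open>bounded B\<close> by (auto simp: bounded_iff)
    have "openin (subtopology \<tau> B) (U \<inter> B)" if "openin ?Q U" for U
      using openin_topology_generated_by[OF that[unfolded seminorm_topology_def]]
    proof (induction rule: generate_topology_on.induct)
      case (Int a b)
      then show ?case using openin_Int[OF Int.IH] by (simp add: Int_ac)
    next
      case (UN K)
      then have "openin (subtopology \<tau> B) (\<Union> ((\<lambda>k. k \<inter> B) ` K))" by (intro openin_Union) auto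
      then show ?case by (simp add: Int_commute flip: Int_UN_distrib2)
    next
      case (Basis s)
      then obtain r x e where s: "s = {y. r (y - x) < e}" "r \<in> insert q P" "0 < e" by blast
      show ?case
      proof (cases "r \<in> P")
        case True
        then show ?thesis
          using openin_seminorm_ball[OF True s(3)] s(1) unfolding tau by (auto intro: openin_subtopology_Int)
      next
        case False
        then have "r = q" using s by blast
        show ?thesis
        proof (subst openin_subopen, intro ballI)
          fix y assume "y \<in> s \<inter> B"
          define d where "d = (e - q (y - x)) / 2"
          have d: "0 < d" using \<open>y \<in> s \<inter> B\<close> s \<open>r = q\<close> by (simp add: d_def)
          obtain K :: nat where K: "real K > 2 * C / d"
            using reals_Archimedean2 by blast
          define V where "V = (\<Inter>k\<in>{..K}. {z. p k (z - y) < d})"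
          have "openin \<tau> V"
            unfolding V_def tau using openin_seminorm_ball[OF p d] by (intro openin_INT2) auto
          moreover have "y \<in> V"
            using d real_seminorm_zero[OF P_real[OF p]] by (simp add: V_def)
          moreover have "V \<inter> B \<subseteq> s \<inter> B"
          proof
            fix z assume z: "z \<in> V \<inter> B"
            have "q (z - y) \<le> d"
            proof (rule q_facts(3))
              fix k
              show "inverse (real (Suc k)) * p k (z - y) \<le> d"
              proof (cases "k \<le> K")
                case True
                then have "p k (z - y) < d" using z by (auto simp: V_def)
                then show ?thesis using weight[of k "z - y"] by linarith
              next
                case False
                have "p k (z - y) \<le> norm z + norm y"
                  using P_le_norm[OF p] norm_triangle_ineq4 order_trans by blast
                also have "\<dots> \<le> 2 * C"
                  using C[of z] C[of y] z \<open>y \<in> s \<inter> B\<close> by simp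
                also have "2 * C \<le> d * real (Suc k)"
                proof -
                  have "2 * C < real K * d" using K d by (simp add: pos_divide_less_eq)
                  also have "\<dots> \<le> real (Suc k) * d" using False d by (intro mult_right_mono) auto
                  finally show ?thesis by (simp add: mult.commute)
                qed
                finally have "p k (z - y) \<le> d * real (Suc k)" .
                then have "p k (z - y) / real (Suc k) \<le> d" by (subst pos_divide_le_eq) auto
                then show ?thesis by (simp only: divide_inverse mult.commute)
              qed
            qed
            then have "q (z - x) < e"
              using real_seminorm_triangle[OF q_real, of z x y] d unfolding d_def by argo
            then show "z \<in> s \<inter> B" using z s \<open>r = q\<close> by simp
          qed
          ultimately show "\<exists>T. openin (subtopology \<tau> B) T \<and> y \<in> T \<and> T \<subseteq> s \<inter> B"
            using \<open>y \<in> s \<inter> B\<close> openin_subtopology_Int by blast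
        qed
      qed
    qed auto
    then show "openin (subtopology \<tau> B) S" if "openin (subtopology ?Q B) S" for S
      using that unfolding openin_subtopology[of ?Q] by blast
  qed
  moreover have "linear_topology smul ?Q"
    by (rule linear_topology_seminorm_topology[OF over]) (use q_facts(1) P_over in auto)
  ultimately show ?thesis
    unfolding mixed_candidate_def using coarser by blast
qed

text \<open>Along an unbounded sequence choose \<open>p k \<in> P\<close> and indices with \<open>p k (u (n k)) > (k + 1)^2\<close>. The seminorm \<open>q\<close>
  with weights \<open>1 / (k + 1)\<close> still exceeds \<open>k + 1\<close> there, although it is \<open>\<gamma>\<close>-continuous, since \<open>\<gamma>\<close> is
  the finest candidate.\<close>
lemma gamma_limit_bounded:
  assumes "limitin \<gamma> u l sequentially"
  shows "bounded (range u)"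
proof (rule ccontr)
  assume unb: "\<not> bounded (range u)"
  have "\<exists>n\<ge>k. \<exists>p\<in>P. (real (Suc k))\<^sup>2 < p (u n)" for k
  proof (rule ccontr)
    assume "\<not> ?thesis"
    then have "norm (u n) \<le> (real (Suc k))\<^sup>2" if "n \<ge> k" for n
      using that by (intro P_norm_leI) (meson not_le)
    then have "u n \<in> u ` {..<k} \<union> cball 0 ((real (Suc k))\<^sup>2)" for n
      by (cases "n < k") (auto simp del: of_nat_Suc)
    then have "range u \<subseteq> u ` {..<k} \<union> cball 0 ((real (Suc k))\<^sup>2)"
      by blast
    then show False
      using unb by (meson bounded_Un bounded_cball bounded_subset finite_imageI finite_imp_bounded finite_lessThan)
  qed
  then obtain n p where np: "k \<le> n k" "p k \<in> P" "(real (Suc k))\<^sup>2 < p k (u (n k))" for k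
    by metis
  define q where "q = (\<lambda>x. SUP k. inverse (real (Suc k)) * p k x)"
  have w: "0 \<le> inverse (real (Suc k))" "inverse (real (Suc k)) \<le> 1" for k
    by (auto simp: field_simps)
  have q_eq: "q x = (SUP k. inverse (real (Suc k)) * p k x)" for x
    by (simp add: q_def)
  note q_facts = seminorm_SUP[where p = p and w = "\<lambda>k. inverse (real (Suc k))",
      OF over P_over[OF np(2)] P_le_norm[OF np(2)] w q_eq]
  have q_real: "real_seminorm q"
    using seminorm_over_imp_real_seminorm[OF over q_facts(1)] .
  have "coarser_eq (seminorm_topology (insert q P)) \<gamma>"
    using mixed mixed_candidate_insert[of p, OF np(2), folded q_def]
    unfolding is_mixed_topology_def by blast
  then have "openin \<gamma> {y. q (y - l) < 1}"
    using openin_seminorm_ball[of q "insert q P" 1 l] by (simp add: coarser_eq_def)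
  moreover have "l \<in> {y. q (y - l) < 1}"
    by (simp add: real_seminorm_zero[OF q_real])
  ultimately have "eventually (\<lambda>m. u m \<in> {y. q (y - l) < 1}) sequentially"
    using assms unfolding limitin_def by blast
  then obtain N where N: "q (u m - l) < 1" if "m \<ge> N" for m
    unfolding eventually_sequentially by auto
  obtain k where k: "real k > max (real N) (q l)"
    using reals_Archimedean2 by blast
  then have "q (u (n k) - l) < 1"
    using np(1)[of k] by (intro N) linarith
  then have "q (u (n k)) < 1 + q l"
    using real_seminorm_add[OF q_real, of "u (n k) - l" l] by simp
  moreover have "real (Suc k) < inverse (real (Suc k)) * p k (u (n k))"
    using np(3)[of k] by (simp add: power2_eq_square inverse_eq_divide pos_less_divide_eq del: of_nat_Suc)
  ultimately show False
    using q_facts(2)[of k "u (n k)"] k by simp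
qed

lemma tau_coarser_gamma: "coarser_eq \<tau> \<gamma>"
  and gamma_on_bounded: "bounded B \<Longrightarrow> subtopology \<gamma> B = subtopology \<tau> B"
  and topspace_gamma: "topspace \<gamma> = UNIV"
  using mixed unfolding is_mixed_topology_def mixed_candidate_def linear_topology_def by blast+

text \<open>A convergent sequence together with its limit is a bounded set, and on bounded sets \<open>\<gamma>\<close> and \<open>\<tau>\<close>
  agree.\<close>
lemma limitin_gamma:
  "limitin \<gamma> u l sequentially \<longleftrightarrow> bounded (range u) \<and> (\<forall>p\<in>P. (\<lambda>n. p (u n - l)) \<longlonglongrightarrow> 0)"
proof (intro iffI conjI)
  assume lim: "limitin \<gamma> u l sequentially"
  then show "bounded (range u)" by (rule gamma_limit_bounded)
  have "limitin \<tau> u l sequentially"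
    using lim tau_coarser_gamma topspace_seminorm_topology[OF P_nonempty P_real]
    unfolding limitin_def coarser_eq_def tau by blast
  then show "\<forall>p\<in>P. (\<lambda>n. p (u n - l)) \<longlonglongrightarrow> 0"
    unfolding limitin_tau .
next
  assume *: "bounded (range u) \<and> (\<forall>p\<in>P. (\<lambda>n. p (u n - l)) \<longlonglongrightarrow> 0)"
  let ?B = "insert l (range u)"
  have "limitin (subtopology \<tau> ?B) u l sequentially"
    using * by (simp add: limitin_subtopology limitin_tau)
  then have "limitin (subtopology \<gamma> ?B) u l sequentially"
    using * gamma_on_bounded[of ?B] by simp
  then show "limitin \<gamma> u l sequentially"
    by (simp add: limitin_subtopology)
qed

sublocale norming_seminorms P
proof
  show "real_seminorm p" if "p \<in> P" for p using P_real[OF that] .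
  show "p x \<le> norm x" if "p \<in> P" for p x using P_le_norm[OF that] .
  show "norm x \<le> c" if "\<And>p. p \<in> P \<Longrightarrow> p x \<le> c" for x c using P_norm_leI[OF that] .
  fix u :: "nat \<Rightarrow> 'a"
  assume bd: "bounded (range u)"
    and cauchy: "\<And>p e. p \<in> P \<Longrightarrow> 0 < e \<Longrightarrow> \<exists>N. \<forall>m\<ge>N. \<forall>n\<ge>N. p (u m - u n) < e"
  \<comment> \<open>A failure of the Cauchy property for \<open>\<gamma>\<close> would yield differences that stay outside a neighbourhood of
    \<open>0\<close>; but these differences are bounded and null for every seminorm, hence null for \<open>\<gamma>\<close>.\<close>
  have "top_Cauchy \<gamma> u"
    unfolding top_Cauchy_def
  proof (intro allI impI, elim conjE)
    fix U assume U: "openin \<gamma> U" "0 \<in> U"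
    show "\<exists>N. \<forall>m\<ge>N. \<forall>n\<ge>N. u m - u n \<in> U"
    proof (rule ccontr)
      assume "\<not> ?thesis"
      then obtain m n where mn: "m N \<ge> N" "n N \<ge> N" "u (m N) - u (n N) \<notin> U" for N
        by metis
      have "limitin \<gamma> (\<lambda>N. u (m N) - u (n N)) 0 sequentially"
        unfolding limitin_gamma
      proof (intro conjI ballI)
        show "bounded (range (\<lambda>N. u (m N) - u (n N)))"
          by (intro bounded_minus_comp) (auto intro: bounded_subset[OF bd])
        fix p assume p: "p \<in> P"
        show "(\<lambda>N. p (u (m N) - u (n N) - 0)) \<longlonglongrightarrow> 0"
        proof (rule tendstoI)
          fix e :: real assume "0 < e"
          from cauchy[OF p this] obtain N where N: "\<forall>m\<ge>N. \<forall>n\<ge>N. p (u m - u n) < e" by blast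
          have "p (u (m k) - u (n k)) < e" if "k \<ge> N" for k
            using N mn(1,2)[of k] that by (meson order_trans)
          then show "eventually (\<lambda>N. dist (p (u (m N) - u (n N) - 0)) 0 < e) sequentially"
            using real_seminorm_nonneg[OF P_real[OF p]] by (auto simp: eventually_sequentially dist_real_def)
        qed
      qed
      then show False
        using U mn(3) unfolding limitin_sequentially by blast
    qed
  qed
  then obtain l where "limitin \<gamma> u l sequentially"
    using seq_complete unfolding seq_complete_on_def by blast
  then show "\<exists>l. \<forall>p\<in>P. (\<lambda>n. p (u n - l)) \<longlonglongrightarrow> 0"
    unfolding limitin_gamma by blast
qed

lemma limitin_gamma_iff_conv: "limitin \<gamma> u l sequentially \<longleftrightarrow> conv u l"
  by (simp add: limitin_gamma conv_def)

end

section \<open>Bi-continuous semigroups on Saks spaces\<close>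

text \<open>One-sided limits at \<open>0\<close> are determined by sequences, so the generator defined by the topology \<open>\<gamma>\<close> is the
  one defined by \<^const>\<open>norming_seminorms.conv\<close>.\<close>
lemma limitin_at_right_iff_sequentially:
  "limitin X f l (at_right (0::real)) \<longleftrightarrow>
     (l \<in> topspace X \<and> (\<forall>r. (\<forall>n. 0 < r n) \<longrightarrow> r \<longlonglongrightarrow> 0 \<longrightarrow> limitin X (\<lambda>n. f (r n)) l sequentially))"
proof (intro iffI conjI allI impI)
  assume lim: "limitin X f l (at_right 0)"
  then show "l \<in> topspace X" by (simp add: limitin_def)
  fix r :: "nat \<Rightarrow> real" assume "\<forall>n. 0 < r n" "r \<longlonglongrightarrow> 0"
  then have "filterlim r (at_right 0) sequentially"
    by (auto simp: filterlim_at eventually_sequentially less_imp_neq[THEN not_sym])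
  then show "limitin X (\<lambda>n. f (r n)) l sequentially"
    using lim unfolding limitin_def by (auto dest: eventually_compose_filterlim)
next
  assume *: "l \<in> topspace X \<and>
      (\<forall>r. (\<forall>n. 0 < r n) \<longrightarrow> r \<longlonglongrightarrow> 0 \<longrightarrow> limitin X (\<lambda>n. f (r n)) l sequentially)"
  show "limitin X f l (at_right 0)"
    unfolding limitin_def
  proof (intro conjI allI impI)
    fix U assume "openin X U \<and> l \<in> U"
    then show "eventually (\<lambda>t. f t \<in> U) (at_right 0)"
      using * by (intro sequentially_imp_eventually_at_right[of 0 1]) (auto simp: limitin_def)
  qed (use * in blast)
qed

locale mixed_saks_semigroup = mixed_saks smul \<tau> \<gamma> P
  for smul :: "'k::real_or_complex \<Rightarrow> 'a::banach \<Rightarrow> 'a"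
    and \<tau> \<gamma> :: "'a topology" and P :: "('a \<Rightarrow> real) set" +
  fixes T :: "real \<Rightarrow> ('a \<Rightarrow>\<^sub>L 'a)"
  assumes semigroup: "bicontinuous_semigroup smul \<gamma> T"
begin

lemmas semigroup_unfolded = semigroup[unfolded bicontinuous_semigroup_def]

lemma T_bounded_op: "0 \<le> t \<Longrightarrow> T t \<in> bounded_ops smul"
  using semigroup_unfolded[THEN conjunct1] by simp

lemma T_id: "T 0 = id_blinfun"
  using semigroup_unfolded[THEN conjunct2, THEN conjunct1] .

lemma T_plus: "0 \<le> t \<Longrightarrow> 0 \<le> s \<Longrightarrow> T (t + s) = T t o\<^sub>L T s"
  using semigroup_unfolded[THEN conjunct2, THEN conjunct2, THEN conjunct1] by simp

lemma T_orbit: "continuous_map (top_of_set {0..}) \<gamma> (\<lambda>t. T t x)"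
  using semigroup_unfolded[THEN conjunct2, THEN conjunct2, THEN conjunct2, THEN conjunct1] by simp

lemma T_locally_uniform:
  assumes "limitin \<gamma> u x sequentially" "0 \<le> b" "openin \<gamma> U" "0 \<in> U"
  shows "\<exists>N. \<forall>n\<ge>N. \<forall>t\<in>{0..b}. T t (u n - x) \<in> U"
  using semigroup_unfolded[THEN conjunct2, THEN conjunct2, THEN conjunct2, THEN conjunct2] assms
  by simp

lemma smul_linear_T: "0 \<le> t \<Longrightarrow> Vector_Spaces.linear smul smul (blinfun_apply (T t))"
  using T_bounded_op by (simp add: bounded_ops_def)

sublocale seminorm_bicontinuous_semigroup P T
proof
  show "T 0 x = x" for x
    by (simp add: T_id)
  show "T (s + t) x = T s (T t x)" if "0 \<le> s" "0 \<le> t" for s t x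
    by (simp add: T_plus[OF that])
  show "conv (\<lambda>n. T (r n) x) (T t x)" if r: "\<And>n. 0 \<le> r n" "r \<longlonglongrightarrow> t" for r t x
  proof -
    have "0 \<le> t" using r by (intro LIMSEQ_le_const) auto
    then have "limitin (top_of_set {0..}) r t sequentially"
      using r by (simp add: limitin_subtopology)
    then have "limitin \<gamma> ((\<lambda>t. T t x) \<circ> r) (T t x) sequentially"
      by (rule continuous_map_limit[OF T_orbit])
    then show ?thesis by (simp add: o_def limitin_gamma_iff_conv)
  qed
  show "conv (\<lambda>n. T (r n) (u n)) 0" if u: "conv u 0" and r: "\<And>n. 0 \<le> r n \<and> r n \<le> b" for u r b
  proof -
    have "0 \<le> b" using r[of 0] by linarith
    have "limitin \<gamma> (\<lambda>n. T (r n) (u n)) 0 sequentially"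
      unfolding limitin_sequentially
    proof (intro conjI allI impI)
      fix U assume U: "openin \<gamma> U \<and> 0 \<in> U"
      have "limitin \<gamma> u 0 sequentially" using u by (simp add: limitin_gamma_iff_conv)
      then obtain N where "\<forall>n\<ge>N. \<forall>t\<in>{0..b}. T t (u n - 0) \<in> U"
        using T_locally_uniform[OF _ \<open>0 \<le> b\<close>] U by blast
      then show "\<exists>N. \<forall>n\<ge>N. T (r n) (u n) \<in> U"
        using r by (auto intro!: exI[of _ N])
    qed (simp add: topspace_gamma)
    then show ?thesis by (simp add: limitin_gamma_iff_conv)
  qed
qed

lemma limitin_gen: "limitin \<gamma> (\<lambda>t. (1 / t) *\<^sub>R (T t x - x)) y (at_right 0) \<longleftrightarrow> gen T x y"
  by (simp add: limitin_at_right_iff_sequentially topspace_gamma limitin_gamma_iff_conv gen_def)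

lemma semigroup_dom_iff: "x \<in> semigroup_dom \<gamma> T \<longleftrightarrow> (\<exists>y. gen T x y)"
  by (simp add: semigroup_dom_def generator_dom_def limitin_gen)

lemma semigroup_gen_eq: "gen T x y \<Longrightarrow> semigroup_gen \<gamma> T x = y"
  unfolding semigroup_gen_def generator_op_def limitin_gen using gen_unique by blast

lemma gen_semigroup_gen: "x \<in> semigroup_dom \<gamma> T \<Longrightarrow> gen T x (semigroup_gen \<gamma> T x)"
  using semigroup_dom_iff semigroup_gen_eq by blast

lemma commuting_smul: "commuting (smul \<mu>)"
  unfolding commuting_def
proof (intro conjI allI impI)
  show "conv_cont (smul \<mu>)"
  proof (rule conv_contI_null)
    show "linear (smul \<mu>)"
      by (rule linearI) (simp_all add: scale_right_distrib mult.commute flip: scale_of_real)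
    fix u assume u: "conv u 0"
    show "conv (\<lambda>n. smul \<mu> (u n)) 0"
      unfolding conv_def
    proof (intro conjI ballI)
      obtain U where "norm (u n) \<le> U" for n
        using conv_bounded[OF u] by (auto simp: bounded_iff)
      then have "norm (smul \<mu> (u n)) \<le> norm \<mu> * U" for n
        by (simp add: norm_scale mult_left_mono)
      then show "bounded (range (\<lambda>n. smul \<mu> (u n)))"
        unfolding bounded_iff by blast
      fix p assume p: "p \<in> P"
      then have "p (smul \<mu> x) = norm \<mu> * p x" for x
        using P_over by (simp add: seminorm_over_def)
      then show "(\<lambda>n. p (smul \<mu> (u n) - 0)) \<longlonglongrightarrow> 0"
        using tendsto_mult_right_zero[OF null_seminorm[OF u p], of "norm \<mu>"] by simp
    qed
  qed
  show "smul \<mu> (T s x) = T s (smul \<mu> x)" if "0 \<le> s" for s x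
    using smul_linear_T[OF that] by (simp add: Vector_Spaces.linear_iff)
qed

lemma is_resolvent_semigroup_resolvent:
  assumes "\<mu> \<in> semigroup_resolvent_set smul \<gamma> T"
  shows "is_resolvent (smul \<mu>) (semigroup_resolvent smul \<gamma> T \<mu>)"
proof -
  let ?D = "semigroup_dom \<gamma> T" and ?f = "\<lambda>x. smul \<mu> x - semigroup_gen \<gamma> T x"
  obtain R where bij: "bij_betw ?f ?D UNIV" and R: "blinfun_apply R = inv_into ?D ?f"
    using assms unfolding semigroup_resolvent_set_def resolvent_set_def by blast
  have Req: "semigroup_resolvent smul \<gamma> T \<mu> = R"
    unfolding semigroup_resolvent_def resolvent_def R[symmetric] by (rule blinfun_apply_inverse)
  have "gen T (R y) (smul \<mu> (R y) - y)" for y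
  proof -
    have y: "y \<in> ?f ` ?D" using bij by (simp add: bij_betw_def)
    have "R y \<in> ?D" unfolding R by (rule inv_into_into[OF y])
    moreover have "?f (R y) = y" unfolding R by (rule f_inv_into_f[OF y])
    then have "semigroup_gen \<gamma> T (R y) = smul \<mu> (R y) - y" by (simp add: algebra_simps)
    ultimately show ?thesis using gen_semigroup_gen by metis
  qed
  moreover have "R (smul \<mu> x - z) = x" if "gen T x z" for x z
  proof -
    have "x \<in> ?D" using that semigroup_dom_iff by blast
    then have "R (?f x) = x"
      unfolding R using bij by (intro inv_into_f_f) (auto simp: bij_betw_def)
    then show ?thesis using semigroup_gen_eq[OF that] by simp
  qed
  ultimately show ?thesis unfolding is_resolvent_def Req by blast
qed

text \<open>Linearity over the full scalar field is automatic, because scalar multiplications commute with the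
  semigroup.\<close>
lemma semigroup_resolvent_setI:
  assumes R: "is_resolvent (smul \<mu>) R" and bl: "bounded_linear R"
  shows "\<mu> \<in> semigroup_resolvent_set smul \<gamma> T" "semigroup_resolvent smul \<gamma> T \<mu> = Blinfun R"
    and "Vector_Spaces.linear smul smul R"
proof -
  let ?D = "semigroup_dom \<gamma> T" and ?f = "\<lambda>x. smul \<mu> x - semigroup_gen \<gamma> T x"
  have Rf: "R (?f x) = x" if "x \<in> ?D" for x
    using R gen_semigroup_gen[OF that] unfolding is_resolvent_def by blast
  have gR: "gen T (R y) (smul \<mu> (R y) - y)" for y
    using R unfolding is_resolvent_def by blast
  then have RD: "R y \<in> ?D" and fR: "?f (R y) = y" for y
    using semigroup_dom_iff semigroup_gen_eq[OF gR] by auto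
  have inj: "inj_on ?f ?D" using Rf by (rule inj_on_inverseI)
  moreover have "?f ` ?D = UNIV" using RD fR by (metis (no_types, lifting) UNIV_eq_I image_eqI)
  ultimately have bij: "bij_betw ?f ?D UNIV" by (simp add: bij_betw_def)
  have inv: "inv_into ?D ?f = R"
    by (rule ext) (rule inv_into_f_eq[OF inj RD fR])
  have "R (smul c x) = smul c (R x)" for c x
    by (rule resolvent_commute[OF R commuting_smul]) (simp add: mult.commute)
  then show lin: "Vector_Spaces.linear smul smul R"
    using bl vector_space_axioms by (simp add: Vector_Spaces.linear_iff linear_add bounded_linear.linear)
  have ap: "blinfun_apply (Blinfun R) = R" using bl by (rule bounded_linear_Blinfun_apply)
  show "\<mu> \<in> semigroup_resolvent_set smul \<gamma> T"
    unfolding semigroup_resolvent_set_def resolvent_set_def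
    using bij lin by (auto simp: bounded_ops_def inv ap intro!: exI[of _ "Blinfun R"])
  show "semigroup_resolvent smul \<gamma> T \<mu> = Blinfun R"
    by (simp add: semigroup_resolvent_def resolvent_def inv)
qed

section \<open>Resolvents on the bi-sun dual\<close>

lemma circ_dual_iff:
  "f \<in> circ_dual smul \<tau> \<longleftrightarrow>
     f \<in> norm_dual smul \<and> (\<forall>u l. conv u l \<longrightarrow> (\<lambda>n. blinfun_apply f (u n)) \<longlonglongrightarrow> blinfun_apply f l)"
proof (intro iffI conjI allI impI)
  assume f: "f \<in> circ_dual smul \<tau>"
  then show "f \<in> norm_dual smul" by (simp add: circ_dual_def)
  fix u l assume u: "conv u l"
  then have "bounded (insert l (range u))" by (simp add: conv_bounded)
  moreover have "limitin \<tau> u l sequentially"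
    using u by (simp add: limitin_tau conv_def)
  ultimately show "(\<lambda>n. f (u n)) \<longlonglongrightarrow> f l"
    using f unfolding circ_dual_def by blast
next
  assume f: "f \<in> norm_dual smul \<and> (\<forall>u l. conv u l \<longrightarrow> (\<lambda>n. f (u n)) \<longlonglongrightarrow> f l)"
  have "conv u l" if "bounded B" "range u \<subseteq> B" "limitin \<tau> u l sequentially" for u l B
    using that bounded_subset unfolding limitin_tau conv_def by blast
  with f show "f \<in> circ_dual smul \<tau>"
    unfolding circ_dual_def by blast
qed

text \<open>Put \<open>z = c R y - y\<close>, the generator applied to \<open>R y\<close>. The difference quotient at \<open>y\<close> is \<open>f\<close> of the mean of
  the orbit of \<open>z\<close> over \<open>[0, t]\<close>, so it differs from \<open>f z\<close> by at most the supremum of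
  \<open>norm (T(s)' f - f) * norm z\<close> over \<open>s \<le> t\<close>, which is small uniformly for \<open>y\<close> in the unit ball.\<close>
lemma bi_sun_resolvent_derivative:
  fixes f :: "'a \<Rightarrow>\<^sub>L 'k" and R :: "'a \<Rightarrow>\<^sub>L 'a"
  assumes f: "f \<in> bi_sun_dual smul \<tau> T" and R: "is_resolvent (\<lambda>x. c *\<^sub>R x) (blinfun_apply R)"
  defines "g \<equiv> adjoint_op R f"
  shows "((\<lambda>t. (1 / t) *\<^sub>R (adjoint_op (T t) g - g)) \<longlongrightarrow> c *\<^sub>R g - f) (at_right 0)"
proof (rule tendstoI)
  fix e :: real assume "0 < e"
  define K where "K = \<bar>c\<bar> * norm R + 1"
  have K: "0 < K" by (simp add: K_def add_nonneg_pos)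
  define \<eta> where "\<eta> = e / (2 * K)"
  have \<eta>: "0 < \<eta>" using \<open>0 < e\<close> K by (simp add: \<eta>_def)
  have "((\<lambda>t. norm (adjoint_op (T t) f - f)) \<longlongrightarrow> 0) (at_right 0)"
    using f by (simp add: bi_sun_dual_def)
  then have "eventually (\<lambda>t. norm (adjoint_op (T t) f - f) < \<eta>) (at_right 0)"
    using \<eta> order_tendstoD(2) by blast
  then obtain b where b: "0 < b" "\<And>t. 0 < t \<Longrightarrow> t < b \<Longrightarrow> norm (adjoint_op (T t) f - f) < \<eta>"
    unfolding eventually_at_right_field by blast
  have f_conv: "conv u l \<Longrightarrow> (\<lambda>n. norm (f (u n - l))) \<longlonglongrightarrow> 0" for u l
    using f unfolding bi_sun_dual_def circ_dual_iff
    by (simp add: blinfun.diff_right LIM_zero_iff tendsto_norm_zero)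
  have q: "real_seminorm (\<lambda>x. norm (f x))"
    by (simp add: real_seminorm_def blinfun.add_right blinfun.scaleR_right norm_triangle_ineq)
  have bound: "norm ((1 / t) *\<^sub>R (adjoint_op (T t) g - g) - (c *\<^sub>R g - f)) < e" if t: "0 < t" "t < b" for t
  proof -
    have "norm (((1 / t) *\<^sub>R (adjoint_op (T t) g - g) - (c *\<^sub>R g - f)) y) \<le> (\<eta> * K) * norm y" for y
    proof -
      define z where "z = c *\<^sub>R R y - y"
      have "R (T t y) = T t (R y)"
        using t by (intro resolvent_commute[OF R])
          (auto simp: commuting_def blinfun.scaleR_right conv_cont_T T_commute)
      moreover have "orbit_integral t z = T t (R y) - R y"
        using R t by (intro gen_imp_orbit_integral) (auto simp: is_resolvent_def z_def)
      ultimately have eq: "((1 / t) *\<^sub>R (adjoint_op (T t) g - g) - (c *\<^sub>R g - f)) y = f ((1 / t) *\<^sub>R orbit_integral t z - z)"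
        by (simp add: g_def adjoint_op_def z_def blinfun.diff_left blinfun.scaleR_left blinfun.diff_right
            blinfun.scaleR_right)
      have "norm (f ((1 / t) *\<^sub>R orbit_integral t z - z)) \<le> \<eta> * norm z"
      proof (rule orbit_integral_mean_estimate[OF q f_conv])
        fix s assume s: "0 \<le> s" "s \<le> t"
        show "norm (f (T s z - z)) \<le> \<eta> * norm z"
        proof (cases "s = 0")
          case True
          then show ?thesis using \<eta> by (simp add: T_zero)
        next
          case False
          have "f (T s z - z) = (adjoint_op (T s) f - f) z"
            by (simp add: adjoint_op_def blinfun.diff_left blinfun.diff_right)
          also have "norm \<dots> \<le> norm (adjoint_op (T s) f - f) * norm z" by (rule norm_blinfun)
          also have "\<dots> \<le> \<eta> * norm z"
            using b(2)[of s] s t False by (intro mult_right_mono) auto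
          finally show ?thesis .
        qed
      qed (use t \<eta> in auto)
      moreover have "norm z \<le> K * norm y"
      proof -
        have "norm z \<le> \<bar>c\<bar> * norm (R y) + norm y"
          unfolding z_def using norm_triangle_ineq4[of "c *\<^sub>R R y" y] by simp
        also have "\<dots> \<le> \<bar>c\<bar> * (norm R * norm y) + norm y"
          by (simp add: mult_left_mono norm_blinfun)
        finally show ?thesis by (simp add: K_def algebra_simps)
      qed
      ultimately show ?thesis
        unfolding eq mult.assoc using \<eta> by (meson less_imp_le mult_left_mono order_trans)
    qed
    then have "norm ((1 / t) *\<^sub>R (adjoint_op (T t) g - g) - (c *\<^sub>R g - f)) \<le> \<eta> * K"
      using \<eta> K by (intro norm_blinfun_bound) auto
    also have "\<dots> < e" using K \<open>0 < e\<close> by (simp add: \<eta>_def)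
    finally show ?thesis .
  qed
  show "eventually (\<lambda>t. dist ((1 / t) *\<^sub>R (adjoint_op (T t) g - g)) (c *\<^sub>R g - f) < e) (at_right 0)"
    unfolding eventually_at_right_field using b(1) bound by (auto simp: dist_norm)
qed

text \<open>It remains to see that \<open>R' f\<close> and the limit \<open>c R' f - f\<close> of its difference quotients belong to the bi-sun
  dual; norm continuity of the orbit of \<open>R' f\<close> is a consequence of the existence of that limit.\<close>
lemma bi_sun_resolvent_dom:
  fixes f :: "'a \<Rightarrow>\<^sub>L 'k" and R :: "'a \<Rightarrow>\<^sub>L 'a"
  assumes f: "f \<in> bi_sun_dual smul \<tau> T" and R: "is_resolvent (\<lambda>x. c *\<^sub>R x) (blinfun_apply R)"
    and cont: "conv_cont (blinfun_apply R)" and lin: "Vector_Spaces.linear smul smul (blinfun_apply R)"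
  shows "adjoint_op R f \<in> bi_sun_generator_dom smul \<tau> T"
proof -
  define g where "g = adjoint_op R f"
  note deriv = bi_sun_resolvent_derivative[OF f R, folded g_def]
  have f_lin: "f (x + y) = f x + f y" "f (smul a x) = a * f x"
    and f_conv: "conv u l \<Longrightarrow> (\<lambda>n. f (u n)) \<longlonglongrightarrow> f l"
    and f_sun: "((\<lambda>t. norm (adjoint_op (T t) f - f)) \<longlongrightarrow> 0) (at_right 0)" for x y a u l
    using f unfolding bi_sun_dual_def circ_dual_iff norm_dual_def Vector_Spaces.linear_iff by blast+
  have vs: "vector_space ((*) :: 'k \<Rightarrow> 'k \<Rightarrow> 'k)"
    by unfold_locales (simp_all add: algebra_simps)
  have R_lin: "R (smul a x) = smul a (R x)" for a x
    using lin by (simp add: Vector_Spaces.linear_iff)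
  have g_lin: "g (x + y) = g x + g y" "g (smul a x) = a * g x"
    and g_conv: "conv u l \<Longrightarrow> (\<lambda>n. g (u n)) \<longlonglongrightarrow> g l" for x y a u l
    using f_conv conv_cont_conv[OF cont]
    by (simp_all add: g_def adjoint_op_def R_lin f_lin blinfun.add_right)
  have g_circ: "g \<in> circ_dual smul \<tau>"
    unfolding circ_dual_iff norm_dual_def Vector_Spaces.linear_iff
    using g_lin g_conv vs vector_space_axioms by blast
  have "((\<lambda>t. t *\<^sub>R ((1 / t) *\<^sub>R (adjoint_op (T t) g - g))) \<longlongrightarrow> 0 *\<^sub>R (c *\<^sub>R g - f)) (at_right 0)"
    by (intro tendsto_scaleR deriv tendsto_ident_at)
  moreover have "eventually (\<lambda>t. t *\<^sub>R ((1 / t) *\<^sub>R (adjoint_op (T t) g - g)) = adjoint_op (T t) g - g) (at_right 0)"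
    unfolding eventually_at_right_field by (intro exI[of _ 1]) auto
  ultimately have "((\<lambda>t. adjoint_op (T t) g - g) \<longlongrightarrow> 0) (at_right 0)"
    using Lim_transform_eventually by fastforce
  then have g_sun: "((\<lambda>t. norm (adjoint_op (T t) g - g)) \<longlongrightarrow> 0) (at_right 0)"
    by (rule tendsto_norm_zero)
  have "c *\<^sub>R g - f \<in> circ_dual smul \<tau>"
    unfolding circ_dual_iff norm_dual_def Vector_Spaces.linear_iff
  proof (intro CollectI conjI allI impI vs vector_space_axioms)
    show "(c *\<^sub>R g - f) (x + y) = (c *\<^sub>R g - f) x + (c *\<^sub>R g - f) y" for x y
      by (rule blinfun.add_right)
    show "(c *\<^sub>R g - f) (smul a x) = a * (c *\<^sub>R g - f) x" for a x
      by (simp add: blinfun.diff_left blinfun.scaleR_left g_lin f_lin right_diff_distrib)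
    show "(\<lambda>n. (c *\<^sub>R g - f) (u n)) \<longlonglongrightarrow> (c *\<^sub>R g - f) l" if "conv u l" for u l
      unfolding blinfun.diff_left blinfun.scaleR_left
      by (intro tendsto_diff tendsto_scaleR tendsto_const g_conv f_conv that)
  qed
  moreover have "((\<lambda>t. norm (adjoint_op (T t) (c *\<^sub>R g - f) - (c *\<^sub>R g - f))) \<longlongrightarrow> 0) (at_right 0)"
  proof (rule tendsto_norm_zero)
    have "((\<lambda>t. c *\<^sub>R (adjoint_op (T t) g - g) - (adjoint_op (T t) f - f)) \<longlongrightarrow> c *\<^sub>R 0 - 0) (at_right 0)"
      by (intro tendsto_diff tendsto_scaleR tendsto_const tendsto_norm_zero_cancel[OF g_sun]
          tendsto_norm_zero_cancel[OF f_sun])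
    moreover have "c *\<^sub>R (adjoint_op (T t) g - g) - (adjoint_op (T t) f - f) =
        adjoint_op (T t) (c *\<^sub>R g - f) - (c *\<^sub>R g - f)" for t
      by (rule blinfun_eqI)
        (simp add: adjoint_op_def blinfun.diff_left blinfun.scaleR_left, simp add: algebra_simps)
    ultimately show "((\<lambda>t. adjoint_op (T t) (c *\<^sub>R g - f) - (c *\<^sub>R g - f)) \<longlongrightarrow> 0) (at_right 0)"
      by simp
  qed
  ultimately have h: "c *\<^sub>R g - f \<in> bi_sun_dual smul \<tau> T" by (simp add: bi_sun_dual_def)
  have "g \<in> bi_sun_dual smul \<tau> T"
    using g_circ g_sun by (simp add: bi_sun_dual_def)
  with h deriv show ?thesis
    unfolding bi_sun_generator_dom_def generator_dom_def g_def[symmetric] by auto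
qed

lemma Lambda_set_nonempty: "Lambda_set smul \<tau> \<gamma> T \<noteq> {}"
proof -
  \<comment> \<open>Then \<open>exp (- c) = 1 / (norm (T 1) + 1)\<close>, which makes the rescaled operator at time \<open>1\<close> a strict
    contraction.\<close>
  define c where "c = ln (norm (T 1) + 1)"
  have "exp (- c) = inverse (norm (T 1) + 1)"
    by (simp add: c_def exp_minus add_nonneg_pos)
  then have "norm (exp (- c) *\<^sub>R T 1) < 1"
    by (simp add: inverse_eq_divide pos_divide_less_eq add_nonneg_pos)
  then obtain R where bl: "bounded_linear R" and cc: "conv_cont R"
    and R: "is_resolvent (\<lambda>x. c *\<^sub>R x) R"
    using ex_resolvent by blast
  let ?\<mu> = "of_real c :: 'k"
  have "is_resolvent (smul ?\<mu>) R"
    using R by (simp add: scale_of_real[abs_def])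
  note \<mu> = semigroup_resolvent_setI[OF this bl]
  have ap: "blinfun_apply (Blinfun R) = R" using bl by (rule bounded_linear_Blinfun_apply)
  have "?\<mu> \<in> Lambda_set smul \<tau> \<gamma> T"
    unfolding Lambda_set_def
    using \<mu>(1,3) R cc bi_sun_resolvent_dom[where R = "Blinfun R" and c = c] by (auto simp: ap \<mu>(2))
  then show ?thesis by blast
qed

section \<open>The Favard space\<close>

lemma Fav_iff: "x \<in> Fav T \<longleftrightarrow> (\<exists>d>0. \<exists>C. \<forall>t. 0 < t \<and> t < d \<longrightarrow> norm (T t x - x) \<le> C * t)"
proof
  assume "x \<in> Fav T"
  then have "Limsup (at_right 0) (\<lambda>t. ereal (1 / t * norm (T t x - x))) \<noteq> \<infinity>"
    unfolding Fav_def by force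
  then obtain n :: nat where "Limsup (at_right 0) (\<lambda>t. ereal (1 / t * norm (T t x - x))) < ereal (real n)"
    unfolding less_PInf_Ex_of_nat by (elim exE)
  moreover define C where "C = real n"
  ultimately have "Limsup (at_right 0) (\<lambda>t. ereal (1 / t * norm (T t x - x))) < ereal C"
    by simp
  then have "eventually (\<lambda>t. ereal (1 / t * norm (T t x - x)) < ereal C) (at_right 0)"
    by (rule Limsup_lessD)
  then obtain d where d: "d > 0" "\<And>t. 0 < t \<Longrightarrow> t < d \<Longrightarrow> 1 / t * norm (T t x - x) < C"
    unfolding eventually_at_right_field by auto
  have "norm (T t x - x) \<le> C * t" if "0 < t" "t < d" for t
    using d(2)[OF that] that by (simp add: pos_divide_less_eq)
  then show "\<exists>d>0. \<exists>C. \<forall>t. 0 < t \<and> t < d \<longrightarrow> norm (T t x - x) \<le> C * t"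
    using d(1) by blast
next
  assume "\<exists>d>0. \<exists>C. \<forall>t. 0 < t \<and> t < d \<longrightarrow> norm (T t x - x) \<le> C * t"
  then obtain d C where d: "d > 0" "\<And>t. 0 < t \<Longrightarrow> t < d \<Longrightarrow> norm (T t x - x) \<le> C * t" by blast
  have "1 / t * norm (T t x - x) \<le> C" if "0 < t" "t < d" for t
    using d(2)[OF that] that by (simp add: pos_divide_le_eq)
  then have "eventually (\<lambda>t. ereal (1 / t * norm (T t x - x)) \<le> ereal C) (at_right 0)"
    unfolding eventually_at_right_field using d(1) by auto
  then have "Limsup (at_right 0) (\<lambda>t. ereal (1 / t * norm (T t x - x))) \<le> ereal C"
    by (rule Limsup_bounded)
  then show "x \<in> Fav T"
    by (auto simp: Fav_def intro: le_less_trans)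
qed

lemma Fav_imp_resolvent_limit:
  assumes "\<mu> \<in> semigroup_resolvent_set smul \<gamma> T" "x \<in> Fav T"
  shows "\<exists>y::nat \<Rightarrow> 'a. bounded (range y) \<and>
    limitin \<gamma> (\<lambda>n. semigroup_resolvent smul \<gamma> T \<mu> (y n)) x sequentially"
proof -
  obtain d C where "d > 0" "\<And>t. 0 < t \<Longrightarrow> t < d \<Longrightarrow> norm (T t x - x) \<le> C * t"
    using assms(2) Fav_iff by blast
  then show ?thesis
    unfolding limitin_gamma_iff_conv
    by (intro resolvent_limit_of_orbit_Lipschitz[OF is_resolvent_semigroup_resolvent[OF assms(1)], of "norm \<mu>"])
      (auto simp: norm_scale)
qed

lemma iterated_resolvent_limit_imp_Fav:
  fixes y :: "nat \<Rightarrow> 'a"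
  assumes \<mu>: "\<mu> \<in> semigroup_resolvent_set smul \<gamma> T" and y: "bounded (range y)"
    and lim: "limitin \<gamma> (\<lambda>n. (blinfun_apply (semigroup_resolvent smul \<gamma> T \<mu>) ^^ (k + 1)) (y n))
      ((blinfun_apply (semigroup_resolvent smul \<gamma> T \<mu>) ^^ k) x) sequentially"
  shows "x \<in> Fav T"
proof -
  let ?R = "semigroup_resolvent smul \<gamma> T \<mu>"
  obtain Y where Y: "norm (y n) \<le> Y" for n
    using y by (auto simp: bounded_iff)
  have "norm (smul \<mu> (?R (y n)) - y n) \<le> norm \<mu> * (norm ?R * Y) + Y" for n
  proof -
    have "norm (?R (y n)) \<le> norm ?R * Y"
      by (rule order_trans[OF norm_blinfun]) (simp add: Y mult_left_mono)
    then have "norm (smul \<mu> (?R (y n))) \<le> norm \<mu> * (norm ?R * Y)"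
      by (simp add: norm_scale mult_left_mono)
    then show ?thesis
      using Y[of n] norm_triangle_ineq4[of "smul \<mu> (?R (y n))" "y n"] by linarith
  qed
  then have "bounded (range (\<lambda>n. smul \<mu> (?R (y n)) - y n))"
    unfolding bounded_iff by blast
  then obtain C where "\<forall>t. 0 \<le> t \<and> t \<le> 1 \<longrightarrow> norm (T t x - x) \<le> C * t"
    using orbit_Lipschitz_of_resolvent_limit[OF is_resolvent_semigroup_resolvent[OF \<mu>] commuting_smul]
      lim unfolding limitin_gamma_iff_conv by blast
  then show ?thesis
    unfolding Fav_iff by (intro exI[of _ 1] conjI exI[of _ C]) auto
qed

end

theorem theorem6p9:
  fixes smul :: "'k::real_or_complex \<Rightarrow> 'a::banach \<Rightarrow> 'a"
    and \<tau> \<gamma> :: "'a topology"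
    and T :: "real \<Rightarrow> ('a \<Rightarrow>\<^sub>L 'a)"
    and x :: 'a
  assumes "saks_space smul \<tau>"
    and "is_mixed_topology smul \<tau> \<gamma>"
    and "seq_complete_on \<gamma> UNIV"
    and "d_consistent smul \<tau>"
    and "mazur_saks smul \<gamma>"
    and "bicontinuous_semigroup smul \<gamma> T"
  shows "(x \<in> Fav T \<longleftrightarrow>
           (\<exists>\<mu>\<in>Lambda_set smul \<tau> \<gamma> T. \<exists>y::nat \<Rightarrow> 'a. bounded (range y) \<and>
              limitin \<gamma> (\<lambda>n. semigroup_resolvent smul \<gamma> T \<mu> (y n)) x sequentially)) \<and>
         (x \<in> Fav T \<longleftrightarrow>
           (\<forall>\<mu>\<in>Lambda_set smul \<tau> \<gamma> T. \<exists>y::nat \<Rightarrow> 'a. bounded (range y) \<and>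
              limitin \<gamma> (\<lambda>n. semigroup_resolvent smul \<gamma> T \<mu> (y n)) x sequentially)) \<and>
         (x \<in> Fav T \<longleftrightarrow>
           (\<exists>\<mu>\<in>Lambda_set smul \<tau> \<gamma> T. \<exists>(y::nat \<Rightarrow> 'a) (k::nat). bounded (range y) \<and>
              limitin \<gamma> (\<lambda>n. (blinfun_apply (semigroup_resolvent smul \<gamma> T \<mu>) ^^ (k + 1)) (y n))
                ((blinfun_apply (semigroup_resolvent smul \<gamma> T \<mu>) ^^ k) x) sequentially)) \<and>
         (x \<in> Fav T \<longleftrightarrow>
           (\<forall>\<mu>\<in>Lambda_set smul \<tau> \<gamma> T. \<exists>(y::nat \<Rightarrow> 'a) (k::nat). bounded (range y) \<and>
              limitin \<gamma> (\<lambda>n. (blinfun_apply (semigroup_resolvent smul \<gamma> T \<mu>) ^^ (k + 1)) (y n))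
                ((blinfun_apply (semigroup_resolvent smul \<gamma> T \<mu>) ^^ k) x) sequentially))"
    (is "(_ \<longleftrightarrow> (\<exists>\<mu>\<in>?\<Lambda>. ?ii \<mu>)) \<and> _ \<and> (_ \<longleftrightarrow> (\<exists>\<mu>\<in>_. ?iii \<mu>)) \<and> _")
proof -
  obtain P where P: "directed_seminorms smul P" "\<tau> = seminorm_topology P"
      "\<And>x. bdd_above ((\<lambda>p. p x) ` P) \<and> norm x = (SUP p\<in>P. p x)"
    and over: "banach_space_over smul"
    using assms(1) unfolding saks_space_def by blast
  interpret mixed_saks_semigroup smul \<tau> \<gamma> P T
    unfolding mixed_saks_semigroup_def mixed_saks_def mixed_saks_semigroup_axioms_def
    using P over assms by blast
  have \<Lambda>: "\<mu> \<in> ?\<Lambda> \<Longrightarrow> \<mu> \<in> semigroup_resolvent_set smul \<gamma> T" for \<mu>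
    by (simp add: Lambda_set_def)
  have "x \<in> Fav T \<Longrightarrow> ?ii \<mu>" if "\<mu> \<in> ?\<Lambda>" for \<mu>
    using Fav_imp_resolvent_limit[OF \<Lambda>[OF that]] .
  moreover have "?ii \<mu> \<Longrightarrow> ?iii \<mu>" for \<mu>
  proof -
    assume "?ii \<mu>"
    then obtain y :: "nat \<Rightarrow> 'a" where "bounded (range y)"
      "limitin \<gamma> (\<lambda>n. semigroup_resolvent smul \<gamma> T \<mu> (y n)) x sequentially" by blast
    then show "?iii \<mu>" by (intro exI[of _ y] exI[of _ 0]) simp
  qed
  moreover have "?iii \<mu> \<Longrightarrow> x \<in> Fav T" if "\<mu> \<in> ?\<Lambda>" for \<mu>
    using iterated_resolvent_limit_imp_Fav[OF \<Lambda>[OF that]] by blast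
  ultimately show ?thesis
    using Lambda_set_nonempty by blast
qed

end
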